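(* Let $F$ be an order continuous Banach lattice. Then every dispersed closed subspace of $F$ is reflexive, and every DNS operator from $F$ into a Banach space is tauberian.
   Context: A sequence $(e_n)$ in the unit sphere of a closed subspace $E\subset F$ is almost disjoint if there is a disjoint sequence $(f_n)\subset F$ (i.e. $|f_n|\wedge|f_m|=0$ for $n\ne m$) with $\|e_n-f_n\|\to0$; $E$ is dispersed if it contains no almost disjoint sequence. A bounded operator $T:F\to H$ is DNS if for every disjoint sequence of nonzero vectors $(f_n)$ in $F$, the restriction of $T$ to $\overline{\mathrm{span}}\{f_n\}$ is not strictly singular (not bounded below on any infinite-dimensional subspace); equivalently no disjoint normalized sequence $(f_n)$ satisfies $\|Tf_n\|\to0$. $T:F\to H$ between Banach spaces is tauberian if $(T^{**})^{-1}(H)\subset F$ (viewing $F\subset F^{**}$, $H\subset H^{**}$). *)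

theory Defs
  imports "HOL-Analysis.Analysis"
begin

definition labs :: "'a::{ab_group_add, lattice} \<Rightarrow> 'a" where
  "labs x = sup x (- x)"

class banach_lattice = banach + ordered_real_vector + lattice +
  assumes lattice_norm: "sup x (- x) \<le> sup y (- y) \<Longrightarrow> norm x \<le> norm y"

text \<open>Order continuity: every downward directed net decreasing to 0 converges to 0
  in norm. A downward directed set D (indexed by itself, ordered by the reverse of
  the lattice order) with greatest lower bound 0 is such a net.\<close>
definition order_continuous :: "'a::banach_lattice itself \<Rightarrow> bool" where
  "order_continuous _ \<longleftrightarrow>
     (\<forall>D::'a set. D \<noteq> {} \<and> (\<forall>x\<in>D. \<forall>y\<in>D. \<exists>z\<in>D. z \<le> x \<and> z \<le> y)
        \<and> (\<forall>y\<in>D. 0 \<le> y) \<and> (\<forall>z. (\<forall>y\<in>D. z \<le> y) \<longrightarrow> z \<le> 0)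
      \<longrightarrow> (\<forall>\<epsilon>>0. \<exists>x\<in>D. \<forall>y\<in>D. y \<le> x \<longrightarrow> norm y < \<epsilon>))"

definition disjoint_seq :: "(nat \<Rightarrow> 'a::banach_lattice) \<Rightarrow> bool" where
  "disjoint_seq f \<longleftrightarrow> (\<forall>n m. n \<noteq> m \<longrightarrow> inf (labs (f n)) (labs (f m)) = 0)"

definition almost_disjoint :: "'a::banach_lattice set \<Rightarrow> (nat \<Rightarrow> 'a) \<Rightarrow> bool" where
  "almost_disjoint E e \<longleftrightarrow> (\<forall>n. e n \<in> E \<and> norm (e n) = 1) \<and>
     (\<exists>f. disjoint_seq f \<and> (\<lambda>n. norm (e n - f n)) \<longlonglongrightarrow> 0)"

definition dispersed :: "'a::banach_lattice set \<Rightarrow> bool" where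
  "dispersed E \<longleftrightarrow> \<not> (\<exists>e. almost_disjoint E e)"

definition sub_dual :: "'a::real_normed_vector set \<Rightarrow> ('a \<Rightarrow> real) set" where
  "sub_dual E = {g. (\<forall>x\<in>E. \<forall>y\<in>E. g (x + y) = g x + g y)
                  \<and> (\<forall>x\<in>E. \<forall>c. g (c *\<^sub>R x) = c * g x)
                  \<and> (\<exists>K. \<forall>x\<in>E. \<bar>g x\<bar> \<le> K * norm x)
                  \<and> (\<forall>x. x \<notin> E \<longrightarrow> g x = 0)}"

definition sub_dual_norm :: "'a::real_normed_vector set \<Rightarrow> ('a \<Rightarrow> real) \<Rightarrow> real" where
  "sub_dual_norm E g = Sup {\<bar>g x\<bar> | x. x \<in> E \<and> norm x \<le> 1}"

definition sub_bidual :: "'a::real_normed_vector set \<Rightarrow> (('a \<Rightarrow> real) \<Rightarrow> real) set" where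
  "sub_bidual E = {\<Phi>. (\<forall>g\<in>sub_dual E. \<forall>h\<in>sub_dual E. \<Phi> (\<lambda>x. g x + h x) = \<Phi> g + \<Phi> h)
                   \<and> (\<forall>g\<in>sub_dual E. \<forall>c. \<Phi> (\<lambda>x. c * g x) = c * \<Phi> g)
                   \<and> (\<exists>K. \<forall>g\<in>sub_dual E. \<bar>\<Phi> g\<bar> \<le> K * sub_dual_norm E g)}"

definition reflexive_subspace :: "'a::real_normed_vector set \<Rightarrow> bool" where
  "reflexive_subspace E \<longleftrightarrow> (\<forall>\<Phi>\<in>sub_bidual E. \<exists>x\<in>E. \<forall>g\<in>sub_dual E. \<Phi> g = g x)"

definition not_strictly_singular_on ::
    "('a::real_normed_vector \<Rightarrow>\<^sub>L 'b::real_normed_vector) \<Rightarrow> 'a set \<Rightarrow> bool" where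
  "not_strictly_singular_on T M \<longleftrightarrow>
     (\<exists>N. subspace N \<and> N \<subseteq> M \<and> \<not> (\<exists>B. finite B \<and> span B = N)
        \<and> (\<exists>c>0. \<forall>x\<in>N. c * norm x \<le> norm (T x)))"

definition DNS :: "('a::banach_lattice \<Rightarrow>\<^sub>L 'b::real_normed_vector) \<Rightarrow> bool" where
  "DNS T \<longleftrightarrow> (\<forall>f. disjoint_seq f \<and> (\<forall>n. f n \<noteq> 0)
      \<longrightarrow> not_strictly_singular_on T (closure (span (range f))))"

text \<open>Tauberian: (T**)^{-1}(H) \<subseteq> F, where T** Phi = (g \<mapsto> Phi (g \<circ> T)).\<close>
definition tauberian :: "('a::real_normed_vector \<Rightarrow>\<^sub>L 'b::real_normed_vector) \<Rightarrow> bool" where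
  "tauberian T \<longleftrightarrow> (\<forall>\<Phi> :: ('a \<Rightarrow>\<^sub>L real) \<Rightarrow>\<^sub>L real.
      (\<exists>y. \<forall>g :: 'b \<Rightarrow>\<^sub>L real. \<Phi> (g o\<^sub>L T) = g y) \<longrightarrow> (\<exists>x. \<forall>f. \<Phi> f = f x))"

end

theory Submission
  imports Defs "HOL-Library.Lattice_Algebras"
begin

text \<open>Let \<open>\<Phi>\<close> be an element of the bidual of \<open>F\<close>. By Helly's theorem \<open>\<Phi>\<close> is approximated on finitely
  many functionals by points of bounded convex sets \<open>C\<close>, consisting of elements of \<open>E\<close>, or of
  elements whose image under \<open>T\<close> is close to \<open>y = T**\<Phi>\<close>; these sets are directed downwards. If
  differences of points of \<open>C\<close> of norm at least \<open>\<eta>\<close> can be chosen with \<open>|x - x'| \<and> u\<close> arbitrarily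
  small, for every \<open>u \<ge> 0\<close>, then a Kadec--Pelczynski argument perturbs a sequence of them to a
  disjoint sequence, which contradicts dispersedness or DNS. Otherwise
  \<open>|x - x'| \<and> u\<close> small forces \<open>x - x'\<close> small for some \<open>u\<close>. Order continuity yields a positive
  functional that controls the norm on \<open>[0, u]\<close>, and from it a bounded concave functional \<open>J\<close> such
  that points of \<open>C\<close> at which \<open>J\<close> almost attains its supremum have \<open>|x - x'| \<and> u\<close> small. The
  approximate maximizers of \<open>J\<close> therefore cluster around one point of \<open>F\<close>, so \<open>\<Phi>\<close> is a norm limit
  of elements of \<open>F\<close>.\<close>

section \<open>Hahn--Banach extension\<close>

text \<open>Helly's theorem approximates \<open>\<Phi>\<close> only along a net and only on finitely
  many functionals at a time, so no convergent sequence is at hand. What can be used is that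
  averages of approximants are again approximants. Hence the convex sets and the concave
  \<open>J\<close>: the midpoint of two near-maximizers cannot exceed the supremum, so the concavity
  gap of the pair is small. \<open>J\<close> sums \<open>h (inf x s)\<close> over finitely many
  levels \<open>s\<close>, equally spaced multiples of \<open>u\<close>. Each summand is concave,
  and its gap for \<open>a\<close>, \<open>b\<close> is at least \<open>h\<close> of the infimum of
  the positive parts of \<open>a - s\<close> and \<open>s - b\<close>. Fine, wide levels therefore
  detect any difference larger than one step, except where the moduli of \<open>a\<close> and
  \<open>b\<close> are large compared with \<open>u\<close>; that region is cut off at a cost
  controlled by the norm bound. Differences \<open>x - x'\<close> are used, because
  \<open>T x\<close> and \<open>T x'\<close> close to \<open>y\<close> make
  \<open>T (x - x')\<close> small, whereas \<open>T x\<close> need not be small. Both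
  \<open>u\<close> and the cluster point depend on the tolerance \<open>\<eta>\<close>, so
  completeness of the space has to assemble the final point.\<close>

definition sublinear :: "('a::real_vector \<Rightarrow> real) \<Rightarrow> bool" where
  "sublinear p \<longleftrightarrow> (\<forall>x y. p (x + y) \<le> p x + p y) \<and> (\<forall>x. \<forall>c\<ge>0. p (c *\<^sub>R x) = c * p x)"

lemma sublinearI:
  assumes "\<And>x y. p (x + y) \<le> p x + p y" "\<And>c x. c > 0 \<Longrightarrow> p (c *\<^sub>R x) \<le> c * p x" "p 0 = 0"
  shows "sublinear p"
proof -
  have "p (c *\<^sub>R x) = c * p x" if "c \<ge> 0" for c x
  proof (cases "c = 0")
    case False
    with that have c: "c > 0" by simp
    have "p ((1/c) *\<^sub>R (c *\<^sub>R x)) \<le> (1/c) * p (c *\<^sub>R x)"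
      using c by (intro assms(2)) simp
    then have "c * p x \<le> p (c *\<^sub>R x)" using c by (simp add: field_simps)
    with assms(2)[OF c, of x] show ?thesis by simp
  qed (use assms(3) in simp)
  with assms(1) show ?thesis by (simp add: sublinear_def)
qed

lemma sublinear_add: "sublinear p \<Longrightarrow> p (x + y) \<le> p x + p y"
  and sublinear_scale: "sublinear p \<Longrightarrow> c \<ge> 0 \<Longrightarrow> p (c *\<^sub>R x) = c * p x"
  by (auto simp: sublinear_def)

lemma sublinear_zero: "sublinear p \<Longrightarrow> p 0 = 0"
  using sublinear_scale[of p 0 0] by simp

lemma sublinear_ge_minus: "sublinear p \<Longrightarrow> - p (- x) \<le> p x"
  using sublinear_add[of p x "- x"] sublinear_zero[of p] by simp

text \<open>Shared by tilts, infima of chains, the extension theorem, distances to a subspace and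
  the Helly gauge. The index \<open>r\<close> is only required to exist, rather than being a sum of
  \<open>s\<close> and \<open>t\<close>, so that chains fit too: there the smaller of two members
  serves.\<close>

lemma sublinear_INF:
  assumes "T \<noteq> {}"
    and bdd: "\<And>t x. t \<in> T \<Longrightarrow> b x \<le> F t x"
    and sub: "\<And>s t x y. s \<in> T \<Longrightarrow> t \<in> T \<Longrightarrow> \<exists>r\<in>T. F r (x + y) \<le> F s x + F t y"
    and hom: "\<And>t x c. t \<in> T \<Longrightarrow> c > 0 \<Longrightarrow> \<exists>r\<in>T. F r (c *\<^sub>R x) \<le> c * F t x"
    and zero: "\<And>t. t \<in> T \<Longrightarrow> 0 \<le> F t 0" "t0 \<in> T" "F t0 0 = 0"
  shows "sublinear (\<lambda>x. INF t\<in>T. F t x)"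
proof -
  have bd: "bdd_below ((\<lambda>t. F t x) ` T)" for x
    using bdd by (intro bdd_belowI2[where m="b x"])
  have low: "(INF t\<in>T. F t x) \<le> F t x" if "t \<in> T" for t x
    by (rule cINF_lower[OF bd that])
  show ?thesis
  proof (rule sublinearI)
    fix x y
    have "(INF t\<in>T. F t (x + y)) - (INF t\<in>T. F t x) \<le> F t y" if t: "t \<in> T" for t
    proof -
      have "(INF t\<in>T. F t (x + y)) - F t y \<le> F s x" if s: "s \<in> T" for s
      proof -
        obtain r where "r \<in> T" "F r (x + y) \<le> F s x + F t y" using sub[OF s t] by blast
        with low[of r "x + y"] show ?thesis by simp
      qed
      then have "(INF t\<in>T. F t (x + y)) - F t y \<le> (INF s\<in>T. F s x)"
        by (rule cINF_greatest[OF \<open>T \<noteq> {}\<close>])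
      then show ?thesis by simp
    qed
    then have "(INF t\<in>T. F t (x + y)) - (INF t\<in>T. F t x) \<le> (INF t\<in>T. F t y)"
      by (rule cINF_greatest[OF \<open>T \<noteq> {}\<close>])
    then show "(INF t\<in>T. F t (x + y)) \<le> (INF t\<in>T. F t x) + (INF t\<in>T. F t y)" by simp
  next
    fix c :: real and x assume c: "c > 0"
    have "(INF t\<in>T. F t (c *\<^sub>R x)) / c \<le> F t x" if t: "t \<in> T" for t
    proof -
      obtain r where r: "r \<in> T" "F r (c *\<^sub>R x) \<le> c * F t x" using hom[OF t c] by blast
      have "(INF t\<in>T. F t (c *\<^sub>R x)) \<le> c * F t x"
        using low[OF r(1), of "c *\<^sub>R x"] r(2) by linarith
      then show ?thesis using c by (simp add: field_simps)
    qed
    then have "(INF t\<in>T. F t (c *\<^sub>R x)) / c \<le> (INF t\<in>T. F t x)"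
      by (rule cINF_greatest[OF \<open>T \<noteq> {}\<close>])
    then show "(INF t\<in>T. F t (c *\<^sub>R x)) \<le> c * (INF t\<in>T. F t x)"
      using c by (simp add: field_simps)
  next
    have "0 \<le> (INF t\<in>T. F t 0)" by (rule cINF_greatest[OF \<open>T \<noteq> {}\<close> zero(1)])
    with low[OF zero(2), of 0] zero(3) show "(INF t\<in>T. F t 0) = 0" by simp
  qed
qed

text \<open>The infimum over \<open>t \<ge> 0\<close> of
  \<open>q (x + t *\<^sub>R y) - t * q y\<close> has value at most \<open>- q y\<close> at
  \<open>- y\<close>. A minimal functional cannot be lowered this way, which makes it additive;
  under a general one, the tilt forces linear minorants to touch at \<open>y\<close>.\<close>

lemma sublinear_tilt:
  fixes y :: "'a::real_vector"
  assumes q: "sublinear q"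
  obtains r where "sublinear r" "\<And>x. r x \<le> q x" "\<And>x. r x \<le> q (x + y) - q y"
proof -
  let ?F = "\<lambda>t x. q (x + t *\<^sub>R y) - t * q y"
  let ?r = "\<lambda>x. INF t\<in>{0..}. ?F t x"
  have lo: "- q (- x) \<le> ?F t x" if "t \<in> {0..}" for t x
  proof -
    have "q (t *\<^sub>R y) \<le> q (x + t *\<^sub>R y) + q (- x)"
      using sublinear_add[OF q, of "x + t *\<^sub>R y" "- x"] by simp
    with that show ?thesis using sublinear_scale[OF q, of t y] by simp
  qed
  have bd: "bdd_below ((\<lambda>t. ?F t x) ` {0..})" for x
    using lo[of _ x] by (intro bdd_belowI2[where m="- q (- x)"]) auto
  have "sublinear ?r"
  proof (rule sublinear_INF[where b="\<lambda>x. - q (- x)"])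
    fix s t x x' assume "s \<in> {0::real..}" "t \<in> {0::real..}"
    then show "\<exists>r\<in>{0..}. ?F r (x + x') \<le> ?F s x + ?F t x'"
      using sublinear_add[OF q, of "x + s *\<^sub>R y" "x' + t *\<^sub>R y"]
      by (intro bexI[of _ "s + t"]) (auto simp: algebra_simps)
  next
    fix t x and c :: real assume "t \<in> {0::real..}" "c > 0"
    then show "\<exists>r\<in>{0..}. ?F r (c *\<^sub>R x) \<le> c * ?F t x"
      using sublinear_scale[OF q, of c "x + t *\<^sub>R y"]
      by (intro bexI[of _ "c * t"]) (auto simp: algebra_simps)
  next
    show "0 \<le> ?F t 0" if "t \<in> {0..}" for t
      using sublinear_scale[OF q, of t y] that by simp
    show "(0::real) \<in> {0..}" "?F 0 0 = 0" using sublinear_zero[OF q] by auto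
  qed (use lo in auto)
  moreover have "?r x \<le> q x" for x
    using cINF_lower[OF bd, of 0 x] by simp
  moreover have "?r x \<le> q (x + y) - q y" for x
    using cINF_lower[OF bd, of 1 x] by simp
  ultimately show ?thesis by (rule that)
qed

text \<open>A pointwise minimal sublinear functional is linear; this replaces the usual extension
  of partially defined functionals.\<close>

theorem exists_linear_below_sublinear:
  fixes p :: "'a::real_vector \<Rightarrow> real"
  assumes p: "sublinear p"
  obtains h where "linear h" "\<And>x. h x \<le> p x"
proof -
  let ?A = "{q. sublinear q \<and> (\<forall>x. q x \<le> p x)}"
  let ?P = "\<lambda>a b :: 'a \<Rightarrow> real. b \<le> a"
  have "\<exists>m\<in>?A. \<forall>a\<in>?A. ?P m a \<longrightarrow> a = m"
  proof (rule predicate_Zorn)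
    show "partial_order_on ?A (relation_of ?P ?A)"
      by (auto simp: partial_order_on_def preorder_on_def refl_on_def trans_def antisym_def
          relation_of_def)
    fix C assume C: "C \<in> Chains (relation_of ?P ?A)"
    then have CA: "C \<subseteq> ?A" by (auto simp: Chains_def relation_of_def)
    have tot: "a \<le> b \<or> b \<le> a" if "a \<in> C" "b \<in> C" for a b
      using C that by (auto simp: Chains_def relation_of_def)
    show "\<exists>u\<in>?A. \<forall>a\<in>C. ?P a u"
    proof (cases "C = {}")
      case True
      then show ?thesis using p by auto
    next
      case False
      have lo: "- p (- x) \<le> q x" if "q \<in> C" for q x
      proof -
        have "sublinear q" "q (- x) \<le> p (- x)" using that CA by auto
        with sublinear_ge_minus[of q x] show ?thesis by simp
      qed
      have low: "(INF q\<in>C. q x) \<le> q x" if "q \<in> C" for q x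
        using lo[of _ x] by (intro cINF_lower that bdd_belowI2[where m="- p (- x)"])
      obtain q0 where q0: "q0 \<in> C" using False by auto
      have "sublinear (\<lambda>x. INF q\<in>C. q x)"
      proof (rule sublinear_INF[where F="\<lambda>q. q" and b="\<lambda>x. - p (- x)" and ?t0.0=q0])
        fix s t x y assume st: "s \<in> C" "t \<in> C"
        have *: "s (x + y) \<le> s x + s y" "t (x + y) \<le> t x + t y"
          using CA st by (auto intro: sublinear_add)
        show "\<exists>r\<in>C. r (x + y) \<le> s x + t y"
        proof (cases "s \<le> t")
          case True
          then have "s y \<le> t y" by (simp add: le_fun_def)
          with * st show ?thesis by (intro bexI[of _ s]) auto
        next
          case False
          then have "t x \<le> s x" using tot[OF st] by (auto simp: le_fun_def)
          with * st show ?thesis by (intro bexI[of _ t]) auto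
        qed
      next
        fix t x and c :: real assume "t \<in> C" "c > 0"
        then show "\<exists>r\<in>C. r (c *\<^sub>R x) \<le> c * t x"
          using CA by (intro bexI[of _ t]) (auto simp: sublinear_def)
      next
        show "0 \<le> t 0" if "t \<in> C" for t using that CA by (auto simp: sublinear_zero)
        show "q0 \<in> C" "q0 0 = 0" using q0 CA by (auto simp: sublinear_zero)
      qed (use False lo in auto)
      moreover have "(INF q\<in>C. q x) \<le> p x" for x
      proof -
        have "q0 x \<le> p x" using q0 CA by auto
        with low[OF q0, of x] show ?thesis by simp
      qed
      ultimately show ?thesis
        using low by (intro bexI[of _ "\<lambda>x. INF q\<in>C. q x"]) (auto simp: le_fun_def)
    qed
  qed
  then obtain m where m: "sublinear m" "\<And>x. m x \<le> p x"
    and min: "\<And>a. sublinear a \<Longrightarrow> (\<forall>x. a x \<le> p x) \<Longrightarrow> a \<le> m \<Longrightarrow> a = m" by auto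
  have add: "m (x + y) = m x + m y" for x y
  proof (rule antisym)
    obtain r where r: "sublinear r" "\<And>x. r x \<le> m x" "\<And>x. r x \<le> m (x + y) - m y"
      using sublinear_tilt[OF m(1)] by blast
    \<comment> \<open>The tilt lies below \<open>m\<close>, so it equals \<open>m\<close> by
      minimality, and its last bound becomes superadditivity.\<close>
    have "r = m"
      using r(1,2) m(2) by (intro min) (auto simp: le_fun_def intro: order_trans)
    with r(3)[of x] show "m x + m y \<le> m (x + y)" by simp
  qed (rule sublinear_add[OF m(1)])
  have neg: "m (- x) = - m x" for x
    using add[of x "- x"] sublinear_zero[OF m(1)] by simp
  have "m (c *\<^sub>R x) = c *\<^sub>R m x" for c x
  proof (cases "c \<ge> 0")
    case False
    then have "m ((- c) *\<^sub>R x) = (- c) * m x" by (intro sublinear_scale[OF m(1)]) simp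
    with neg[of "c *\<^sub>R x"] show ?thesis by simp
  qed (simp add: sublinear_scale[OF m(1)])
  with add have "linear m" by (intro linearI) auto
  from this m(2) show ?thesis by (rule that)
qed

corollary exists_linear_below_sublinear_at:
  fixes p :: "'a::real_vector \<Rightarrow> real"
  assumes p: "sublinear p"
  obtains h where "linear h" "\<And>x. h x \<le> p x" "h y = p y"
proof -
  obtain r where r: "sublinear r" "\<And>x. r x \<le> p x" "\<And>x. r x \<le> p (x + y) - p y"
    using sublinear_tilt[OF p] by blast
  obtain h where h: "linear h" "\<And>x. h x \<le> r x"
    using exists_linear_below_sublinear[OF r(1)] by blast
  have "h (- y) \<le> - p y" using h(2)[of "- y"] r(3)[of "- y"] sublinear_zero[OF p] by simp
  then have "p y \<le> h y" using linear_neg[OF h(1)] by simp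
  moreover have hp: "h x \<le> p x" for x using h(2) r(2) order_trans by blast
  ultimately show ?thesis using h(1) by (intro that[of h]) (auto intro: antisym)
qed

text \<open>The infimal convolution of \<open>f\<close> on \<open>S\<close> with \<open>p\<close> is
  sublinear, below \<open>p\<close> (take \<open>s = 0\<close>) and below \<open>f\<close> on
  \<open>S\<close> (take \<open>s = x\<close>). A linear functional below \<open>f\<close> on a
  subspace equals \<open>f\<close> there, by comparing at \<open>- x\<close>.\<close>

theorem hahn_banach_extension:
  fixes p f :: "'a::real_vector \<Rightarrow> real"
  assumes p: "sublinear p" and S: "subspace S"
    and add: "\<And>x y. x \<in> S \<Longrightarrow> y \<in> S \<Longrightarrow> f (x + y) = f x + f y"
    and scale: "\<And>c x. x \<in> S \<Longrightarrow> f (c *\<^sub>R x) = c * f x"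
    and le: "\<And>x. x \<in> S \<Longrightarrow> f x \<le> p x"
  obtains h where "linear h" "\<And>x. h x \<le> p x" "\<And>x. x \<in> S \<Longrightarrow> h x = f x"
proof -
  let ?F = "\<lambda>s x. f s + p (x - s)"
  have f0: "f 0 = 0" using scale[of 0 0] S by (simp add: subspace_0)
  have fneg: "f (- x) = - f x" if "x \<in> S" for x using scale[OF that, of "-1"] by simp
  have lo: "- p (- x) \<le> ?F s x" if "s \<in> S" for s x
  proof -
    have "- s \<in> S" using that S by (simp add: subspace_neg)
    then have "- f s \<le> p (- s)" using le[of "- s"] fneg[OF that] by simp
    moreover have "p (- s) \<le> p (x - s) + p (- x)"
      using sublinear_add[OF p, of "x - s" "- x"] by simp
    ultimately show ?thesis by simp
  qed
  have low: "(INF s\<in>S. ?F s x) \<le> ?F s x" if "s \<in> S" for s x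
    using lo[of _ x] by (intro cINF_lower that bdd_belowI2[where m="- p (- x)"])
  have "sublinear (\<lambda>x. INF s\<in>S. ?F s x)"
  proof (rule sublinear_INF[where b="\<lambda>x. - p (- x)"])
    fix s t x y assume "s \<in> S" "t \<in> S"
    then show "\<exists>r\<in>S. ?F r (x + y) \<le> ?F s x + ?F t y"
      using sublinear_add[OF p, of "x - s" "y - t"] add S
      by (intro bexI[of _ "s + t"]) (auto simp: algebra_simps subspace_add)
  next
    fix s x and c :: real assume "s \<in> S" "c > 0"
    then show "\<exists>r\<in>S. ?F r (c *\<^sub>R x) \<le> c * ?F s x"
      using sublinear_scale[OF p, of c "x - s"] scale S
      by (intro bexI[of _ "c *\<^sub>R s"]) (auto simp: algebra_simps subspace_scale)
  next
    show "0 \<le> ?F s 0" if "s \<in> S" for s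
      using le[of "- s"] fneg[OF that] that S by (simp add: subspace_neg)
    show "0 \<in> S" "?F 0 0 = 0" using S f0 sublinear_zero[OF p] by (auto simp: subspace_0)
  qed (use lo S subspace_0 in auto)
  then obtain h where h: "linear h" "\<And>x. h x \<le> (INF s\<in>S. ?F s x)"
    using exists_linear_below_sublinear by blast
  have 1: "h x \<le> f x" if "x \<in> S" for x
    using h(2)[of x] low[OF that, of x] sublinear_zero[OF p] by simp
  have "h x = f x" if "x \<in> S" for x
  proof -
    have "- h x \<le> - f x"
      using 1[of "- x"] that S fneg[OF that] linear_neg[OF h(1), of x] by (simp add: subspace_neg)
    with 1[OF that] show ?thesis by simp
  qed
  moreover have "h x \<le> p x" for x
    using h(2)[of x] low[OF subspace_0[OF S], of x] f0 by simp
  ultimately show ?thesis using h(1) by (intro that)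
qed

section \<open>Norm-bounded functionals\<close>

lemma linear_le_norm_imp_bounded:
  fixes h :: "'a::real_normed_vector \<Rightarrow> real"
  assumes "linear h" "\<And>x. h x \<le> K * norm x"
  shows "bounded_linear h" "\<bar>h x\<bar> \<le> K * norm x"
proof -
  have *: "\<bar>h x\<bar> \<le> K * norm x" for x
    using assms(2)[of x] assms(2)[of "- x"] linear_neg[OF assms(1), of x] by (auto simp: abs_le_iff)
  show "bounded_linear h"
    using assms(1) * by (intro bounded_linear_intro[where K=K])
      (auto simp: linear_add linear_scale mult.commute)
  show "\<bar>h x\<bar> \<le> K * norm x" by (rule *)
qed

theorem hahn_banach_norm_extension:
  fixes f :: "'a::real_normed_vector \<Rightarrow> real"
  assumes S: "subspace S"
    and add: "\<And>x y. x \<in> S \<Longrightarrow> y \<in> S \<Longrightarrow> f (x + y) = f x + f y"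
    and scale: "\<And>c x. x \<in> S \<Longrightarrow> f (c *\<^sub>R x) = c * f x"
    and le: "\<And>x. x \<in> S \<Longrightarrow> \<bar>f x\<bar> \<le> K * norm x"
  obtains h :: "'a \<Rightarrow>\<^sub>L real" where "\<And>x. x \<in> S \<Longrightarrow> h x = f x"
proof -
  \<comment> \<open>A negative \<open>K\<close> is possible when \<open>S\<close> is trivial, hence
    the absolute value.\<close>
  have "sublinear (\<lambda>x::'a. \<bar>K\<bar> * norm x)"
    by (rule sublinearI)
      (auto simp: distrib_left[symmetric] mult_left_mono norm_triangle_ineq)
  moreover have "f x \<le> \<bar>K\<bar> * norm x" if "x \<in> S" for x
    using le[OF that] abs_le_D1 mult_right_mono[OF abs_ge_self[of K] norm_ge_zero[of x]]
    by fastforce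
  ultimately obtain h where h: "linear h" "\<And>x. h x \<le> \<bar>K\<bar> * norm x" "\<And>x. x \<in> S \<Longrightarrow> h x = f x"
    using hahn_banach_extension[OF _ S add scale] by blast
  have "bounded_linear h" by (rule linear_le_norm_imp_bounded(1)[OF h(1,2)])
  with h(3) that[of "Blinfun h"] show ?thesis by (simp add: bounded_linear_Blinfun_apply)
qed

text \<open>The distance to \<open>S\<close> is sublinear, and a linear functional below it is a
  contraction vanishing on \<open>S\<close>. It supplies norming functionals
  (\<open>S = {0}\<close>), coordinate functionals of disjoint sequences, and the test for
  membership in a closed subspace.\<close>

lemma exists_functional_infdist:
  fixes x0 :: "'a::real_normed_vector"
  assumes S: "subspace S"
  obtains h :: "'a \<Rightarrow>\<^sub>L real" where "\<And>x. \<bar>h x\<bar> \<le> norm x" "\<And>x. x \<in> S \<Longrightarrow> h x = 0"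
    "h x0 = infdist x0 S"
proof -
  let ?p = "\<lambda>x. INF s\<in>S. norm (x - s)"
  have S0: "0 \<in> S" using S by (simp add: subspace_0)
  then have ne: "S \<noteq> {}" by auto
  have low: "?p x \<le> norm (x - s)" if "s \<in> S" for s x
    by (intro cINF_lower that bdd_belowI2[where m=0]) simp
  have "sublinear ?p"
  proof (rule sublinear_INF[where b="\<lambda>_. 0" and F="\<lambda>s x. norm (x - s)", OF ne])
    fix s t x y assume "s \<in> S" "t \<in> S"
    then show "\<exists>r\<in>S. norm (x + y - r) \<le> norm (x - s) + norm (y - t)"
      using norm_triangle_ineq[of "x - s" "y - t"] S
      by (intro bexI[of _ "s + t"]) (auto simp: algebra_simps subspace_add)
  next
    fix s x and c :: real assume "s \<in> S" "c > 0"
    then show "\<exists>r\<in>S. norm (c *\<^sub>R x - r) \<le> c * norm (x - s)"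
      using S by (intro bexI[of _ "c *\<^sub>R s"])
        (auto simp: subspace_scale simp flip: scaleR_diff_right)
  qed (use S0 in auto)
  then obtain h where h: "linear h" "\<And>x. h x \<le> ?p x" "h x0 = ?p x0"
    using exists_linear_below_sublinear_at by blast
  have hn: "h x \<le> 1 * norm x" for x using h(2)[of x] low[OF S0, of x] by simp
  note bl = linear_le_norm_imp_bounded[OF h(1) hn]
  have le0: "h x \<le> 0" if "x \<in> S" for x using h(2)[of x] low[OF that, of x] by simp
  have "h x = 0" if "x \<in> S" for x
    using le0[OF that] le0[of "- x"] that S linear_neg[OF h(1), of x] by (simp add: subspace_neg)
  moreover have "?p x0 = infdist x0 S" using ne by (simp add: infdist_def dist_norm)
  ultimately show ?thesis
    using that[of "Blinfun h"] bl h(3) by (simp add: bounded_linear_Blinfun_apply)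
qed

lemma exists_norming_functional:
  fixes x :: "'a::real_normed_vector"
  obtains h :: "'a \<Rightarrow>\<^sub>L real" where "\<And>z. \<bar>h z\<bar> \<le> norm z" "h x = norm x"
proof -
  obtain h :: "'a \<Rightarrow>\<^sub>L real" where "\<And>z. \<bar>h z\<bar> \<le> norm z" "h x = infdist x {0}"
    using exists_functional_infdist[OF subspace_single_0] by blast
  then show ?thesis by (intro that[of h]) auto
qed

section \<open>Banach lattices\<close>

\<comment> \<open>Translation invariance forces distributivity:
  \<open>x + w = sup x w + inf x w\<close> bounds \<open>y\<close> and \<open>z\<close>, and hence
  their supremum, by the single element \<open>d + t - x\<close>. The staircase inequality below
  relies on it.\<close>
subclass (in lattice_ab_group_add) distrib_lattice
proof
  have le: "inf x (sup y z) \<le> sup (inf x y) (inf x z)" for x y z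
  proof -
    define s t d where "s = sup y z" and "t = sup x s" and "d = sup (inf x y) (inf x z)"
    have *: "w \<le> d + t - x" if "w = y \<or> w = z" for w
    proof -
      have "w = inf x w + sup x w - x" using add_eq_inf_sup[of x w] by (simp add: algebra_simps)
      also have "\<dots> \<le> d + t - x"
        using that unfolding d_def t_def s_def
        by (intro diff_right_mono add_mono) (auto intro: le_supI1 le_supI2)
      finally show ?thesis .
    qed
    have "s \<le> d + t - x" using * by (simp add: s_def)
    then have "x + s \<le> d + t" by (simp add: le_diff_eq add.commute)
    moreover have "x + s = t + inf x s" unfolding t_def by (rule add_eq_inf_sup)
    ultimately have "t + inf x s \<le> t + d" by (simp only: add.commute)
    then have "inf x s \<le> d" by (rule add_le_imp_le_left)
    then show ?thesis by (simp only: s_def d_def)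
  qed
  show "sup x (inf y z) = inf (sup x y) (sup x z)" for x y z
    by (rule distrib_imp1, rule order.antisym[OF le distrib_inf_le])
qed

instance banach_lattice \<subseteq> lattice_ab_group_add ..

section \<open>Scaling, modulus and truncation\<close>

lemma inf_scaleR:
  fixes x y :: "'a::banach_lattice"
  assumes "c \<ge> 0" shows "inf (c *\<^sub>R x) (c *\<^sub>R y) = c *\<^sub>R inf x y"
proof (cases "c = 0")
  case False
  with assms have c: "c > 0" by simp
  show ?thesis
  proof (rule antisym)
    have "(1/c) *\<^sub>R inf (c *\<^sub>R x) (c *\<^sub>R y) \<le> (1/c) *\<^sub>R (c *\<^sub>R x)"
      "(1/c) *\<^sub>R inf (c *\<^sub>R x) (c *\<^sub>R y) \<le> (1/c) *\<^sub>R (c *\<^sub>R y)"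
      using c by (intro scaleR_left_mono; simp)+
    then have "(1/c) *\<^sub>R inf (c *\<^sub>R x) (c *\<^sub>R y) \<le> inf x y" using c by simp
    then have "c *\<^sub>R ((1/c) *\<^sub>R inf (c *\<^sub>R x) (c *\<^sub>R y)) \<le> c *\<^sub>R inf x y"
      using c by (intro scaleR_left_mono) auto
    then show "inf (c *\<^sub>R x) (c *\<^sub>R y) \<le> c *\<^sub>R inf x y" using c by simp
    show "c *\<^sub>R inf x y \<le> inf (c *\<^sub>R x) (c *\<^sub>R y)"
      using assms by (simp add: scaleR_left_mono)
  qed
qed simp

lemma sup_scaleR:
  fixes x y :: "'a::banach_lattice"
  assumes "c \<ge> 0" shows "sup (c *\<^sub>R x) (c *\<^sub>R y) = c *\<^sub>R sup x y"
  using inf_scaleR[OF assms, of "- x" "- y"]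
  by (simp only: sup_eq_neg_inf[of x y] sup_eq_neg_inf[of "c *\<^sub>R x"] scaleR_minus_right)

lemma labs_nonneg [simp]: "0 \<le> labs (x::'a::banach_lattice)"
proof -
  have "x + - x \<le> labs x + labs x" unfolding labs_def by (rule add_mono) auto
  then show ?thesis by simp
qed

lemma labs_of_nonneg: "0 \<le> x \<Longrightarrow> labs (x::'a::banach_lattice) = x"
  unfolding labs_def by (rule sup_absorb1) (rule order_trans[of _ 0], simp_all)

lemma labs_labs [simp]: "labs (labs x) = labs (x::'a::banach_lattice)"
  by (simp add: labs_of_nonneg)

lemma labs_uminus [simp]: "labs (- x) = labs (x::'a::banach_lattice)"
  by (simp add: labs_def sup_commute)

lemma labs_ge: "x \<le> labs (x::'a::banach_lattice)" "- x \<le> labs x"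
  by (simp_all add: labs_def)

lemma labs_leI: "x \<le> y \<Longrightarrow> - x \<le> y \<Longrightarrow> labs x \<le> (y::'a::banach_lattice)"
  by (simp add: labs_def)

lemma labs_zero [simp]: "labs (0::'a::banach_lattice) = 0"
  by (simp add: labs_def)

lemma labs_triangle: "labs (x + y) \<le> labs x + labs (y::'a::banach_lattice)"
proof (rule labs_leI)
  have "- x + - y \<le> labs x + labs y" by (intro add_mono labs_ge)
  then show "- (x + y) \<le> labs x + labs y" by simp
qed (intro add_mono labs_ge)

lemma labs_scaleR: "labs (c *\<^sub>R x) = \<bar>c\<bar> *\<^sub>R labs (x::'a::banach_lattice)"
proof (cases "c \<ge> 0")
  case True
  then show ?thesis using sup_scaleR[of c x "- x"] by (simp add: labs_def)
next
  case False
  then show ?thesis using sup_scaleR[of "- c" x "- x"] by (simp add: labs_def sup_commute)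
qed

lemma norm_le_of_labs_le: "labs x \<le> labs y \<Longrightarrow> norm x \<le> norm (y::'a::banach_lattice)"
  using lattice_norm unfolding labs_def .

lemma norm_labs [simp]: "norm (labs x) = norm (x::'a::banach_lattice)"
  by (intro antisym norm_le_of_labs_le) simp_all

lemma norm_mono_nonneg: "0 \<le> x \<Longrightarrow> x \<le> y \<Longrightarrow> norm x \<le> norm (y::'a::banach_lattice)"
  by (rule norm_le_of_labs_le) (simp add: labs_of_nonneg order_trans[of 0 x y])

lemma labs_le_imp_norm_le: "labs x \<le> y \<Longrightarrow> norm x \<le> norm (y::'a::banach_lattice)"
  using norm_mono_nonneg[of "labs x" y] by simp

lemma pos_part_le_labs: "sup x 0 \<le> labs (x::'a::banach_lattice)"
  by (simp add: labs_ge)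

lemma norm_pos_part_le: "norm (sup x 0) \<le> norm (x::'a::banach_lattice)"
  using norm_mono_nonneg[OF _ pos_part_le_labs, of x] by simp

lemma pos_part_diff_neg_part: "sup x 0 - sup (- x) 0 = (x::'a::banach_lattice)"
proof -
  have "sup x 0 - sup (- x) 0 = pprt x + nprt x"
    by (simp only: pprt_def[symmetric] pprt_neg diff_minus_eq_add)
  then show ?thesis by (simp only: prts[symmetric])
qed

lemma pos_part_add_le: "sup (x + y) 0 \<le> sup x 0 + sup (y::'a::banach_lattice) 0"
  by (intro sup_least add_mono add_nonneg_nonneg) simp_all

text \<open>With \<open>w\<close> the left side, \<open>w - inf y u\<close> is the supremum of
  \<open>w - y\<close> and \<open>w - u\<close>, and both lie below \<open>x\<close> and below
  \<open>u\<close>.\<close>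

lemma inf_add_le_add_inf:
  fixes x y u :: "'a::banach_lattice"
  assumes "0 \<le> x" "0 \<le> y" "0 \<le> u"
  shows "inf (x + y) u \<le> inf x u + inf y u"
proof -
  define w where "w = inf (x + y) u"
  have w: "w \<le> x + y" "w \<le> u" by (auto simp: w_def)
  have "w - y \<le> x" using w(1) by (simp add: diff_le_eq)
  moreover have "w - y \<le> u" using order_trans[OF w(2) add_increasing2[OF assms(2) order_refl]]
    by (simp add: diff_le_eq)
  moreover have "w - u \<le> 0" using w(2) by simp
  then have "w - u \<le> x" "w - u \<le> u" using assms order_trans by blast+
  ultimately have "w + sup (- y) (- u) \<le> inf x u"
    unfolding add_sup_distrib_left by simp
  then have "w - inf y u \<le> inf x u" by (simp only: diff_inf_eq_sup)
  then show ?thesis unfolding w_def by (simp only: diff_le_eq)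
qed

lemma inf_add_le: "0 \<le> c \<Longrightarrow> inf x (y + c) \<le> inf x y + (c::'a::banach_lattice)"
  unfolding add_inf_distrib_right
  by (intro inf_greatest le_infI1[OF add_increasing2] le_infI2) simp_all

lemma inf_scaleR_left_le:
  fixes x y :: "'a::banach_lattice"
  assumes "1 \<le> c" "0 \<le> x" "0 \<le> y"
  shows "inf (c *\<^sub>R x) y \<le> c *\<^sub>R inf x y"
proof -
  have "1 *\<^sub>R y \<le> c *\<^sub>R y" using assms by (intro scaleR_right_mono) auto
  then have "inf (c *\<^sub>R x) y \<le> inf (c *\<^sub>R x) (c *\<^sub>R y)" by (intro inf_mono) auto
  with assms show ?thesis by (simp add: inf_scaleR)
qed

lemma labs_inf_le: "labs (inf x y) \<le> labs x + labs (y::'a::banach_lattice)"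
proof (rule labs_leI)
  have "x \<le> labs x + labs y" by (simp add: add_increasing2 labs_ge)
  then show "inf x y \<le> labs x + labs y" by (rule le_infI1)
  have "- x \<le> labs x + labs y" "- y \<le> labs x + labs y"
    by (simp_all add: add_increasing add_increasing2 labs_ge)
  then show "- inf x y \<le> labs x + labs y" unfolding neg_inf_eq_sup by simp
qed

section \<open>Order and norm convergence\<close>

lemma nonneg_lim:
  fixes X :: "nat \<Rightarrow> 'a::banach_lattice"
  assumes "X \<longlonglongrightarrow> x" "\<forall>\<^sub>F n in sequentially. 0 \<le> X n"
  shows "0 \<le> x"
proof -
  have "(\<lambda>n. norm (X n - x)) \<longlonglongrightarrow> 0" using assms(1) by (simp add: LIM_zero tendsto_norm_zero)
  moreover have "\<forall>\<^sub>F n in sequentially. norm (sup (- x) 0) \<le> norm (X n - x)"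
    using assms(2)
  proof eventually_elim
    case (elim n)
    then have "- x \<le> X n - x" by simp
    then have "sup (- x) 0 \<le> sup (X n - x) 0" by (intro sup_mono) auto
    then have "norm (sup (- x) 0) \<le> norm (sup (X n - x) 0)" by (intro norm_mono_nonneg) auto
    also have "\<dots> \<le> norm (X n - x)" by (rule norm_pos_part_le)
    finally show ?case .
  qed
  ultimately have "norm (sup (- x) 0) \<le> 0"
    by (intro tendsto_lowerbound[of "\<lambda>n. norm (X n - x)"]) auto
  then have "sup (- x) 0 = 0" by simp
  then show ?thesis by (metis neg_le_0_iff_le sup.cobounded1)
qed

lemma lim_mono_lattice:
  fixes X Y :: "nat \<Rightarrow> 'a::banach_lattice"
  assumes "X \<longlonglongrightarrow> x" "Y \<longlonglongrightarrow> y" "\<And>n. X n \<le> Y n"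
  shows "x \<le> y"
  using nonneg_lim[OF tendsto_diff[OF assms(2,1)]] assms(3) by simp

lemma archimedean_lattice:
  fixes z v :: "'a::banach_lattice"
  assumes "\<And>n::nat. real n *\<^sub>R z \<le> v"
  shows "z \<le> 0"
proof -
  have "(\<lambda>n. (1 / real (Suc n)) *\<^sub>R v - z) \<longlonglongrightarrow> 0 *\<^sub>R v - z"
    by (intro tendsto_intros) (use lim_1_over_n LIMSEQ_Suc in blast)
  moreover have "0 \<le> (1 / real (Suc n)) *\<^sub>R v - z" for n
    using scaleR_left_mono[OF assms[of "Suc n"], of "1 / real (Suc n)"] by simp
  ultimately have "0 \<le> 0 *\<^sub>R v - z" by (intro nonneg_lim) auto
  then show ?thesis by simp
qed

text \<open>A supremum of \<open>X\<close> is not known to exist, so nothing can be subtracted from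
  it. The differences \<open>v - X n\<close> over all upper bounds \<open>v\<close> form a directed
  set that takes its place; once one of them is small in norm, so are all later increments of
  \<open>X\<close>.\<close>

lemma order_continuous_incseq_Cauchy:
  fixes X :: "nat \<Rightarrow> 'a::banach_lattice"
  assumes oc: "order_continuous TYPE('a)" and inc: "incseq X" and le: "\<And>n. X n \<le> u"
  shows "convergent X"
proof -
  let ?D = "{v - X n | v n. \<forall>k. X k \<le> v}"
  have mono: "X m \<le> X n" if "m \<le> n" for m n using inc that by (simp add: incseqD)
  have d1: "?D \<noteq> {}" using le by blast
  have d2: "\<exists>z\<in>?D. z \<le> x \<and> z \<le> y" if xy: "x \<in> ?D" "y \<in> ?D" for x y
  proof -
    obtain v n where v: "x = v - X n" "\<forall>k. X k \<le> v" using xy(1) by blast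
    obtain w m where w: "y = w - X m" "\<forall>k. X k \<le> w" using xy(2) by blast
    have "inf v w - X (max n m) \<in> ?D" using v(2) w(2) by auto
    moreover have "inf v w - X (max n m) \<le> x" "inf v w - X (max n m) \<le> y"
      unfolding v(1) w(1) by (intro diff_mono mono; simp)+
    ultimately show ?thesis by blast
  qed
  have d3: "0 \<le> y" if "y \<in> ?D" for y using that by auto
  have d4: "z \<le> 0" if z: "\<forall>y\<in>?D. z \<le> y" for z
  proof -
    \<comment> \<open>If \<open>z\<close> is below every \<open>v - X n\<close>, then
      \<open>v - z\<close> is an upper bound whenever \<open>v\<close> is; iterating from
      \<open>u\<close> makes all multiples of \<open>z\<close> bounded above.\<close>
    have ub: "X k \<le> u - real j *\<^sub>R z" for j k
    proof (induction j arbitrary: k)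
      case (Suc j)
      have "z \<le> (u - real j *\<^sub>R z) - X k" using z Suc by blast
      then show ?case by (simp add: algebra_simps)
    qed (simp add: le)
    have "real j *\<^sub>R z \<le> u - X 0" for j using ub[of 0 j] by (simp add: algebra_simps)
    then show ?thesis by (rule archimedean_lattice)
  qed
  have "?D \<noteq> {} \<and> (\<forall>x\<in>?D. \<forall>y\<in>?D. \<exists>z\<in>?D. z \<le> x \<and> z \<le> y) \<and> (\<forall>y\<in>?D. 0 \<le> y)
      \<and> (\<forall>z. (\<forall>y\<in>?D. z \<le> y) \<longrightarrow> z \<le> 0)"
    by (intro conjI ballI allI impI d1 d2 d3 d4; (assumption | (erule bspec, assumption)))
  then have "\<forall>e>0. \<exists>x\<in>?D. \<forall>y\<in>?D. y \<le> x \<longrightarrow> norm y < e"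
    by (rule oc[unfolded order_continuous_def, THEN spec, THEN mp])
  then have small: "\<exists>x\<in>?D. norm x < e" if "e > 0" for e
    using that by (blast intro: order_refl)
  have "Cauchy X"
  proof (rule CauchyI)
    fix e :: real assume "e > 0"
    then obtain x where "x \<in> ?D" "norm x < e / 2" using small[of "e/2"] by (auto simp only: half_gt_zero)
    then obtain v n where v: "norm (v - X n) < e / 2" "\<forall>k. X k \<le> v" by blast
    have b: "norm (X m - X n) < e / 2" if "m \<ge> n" for m
    proof -
      have "norm (X m - X n) \<le> norm (v - X n)"
        using mono[OF that] v(2) by (intro norm_mono_nonneg) (auto intro: diff_right_mono)
      with v(1) show ?thesis by simp
    qed
    have "norm (X m - X k) < e" if "m \<ge> n" "k \<ge> n" for m k
      using norm_triangle_ineq4[of "X m - X n" "X k - X n"] b[OF that(1)] b[OF that(2)] by simp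
    then show "\<exists>M. \<forall>m\<ge>M. \<forall>n\<ge>M. norm (X m - X n) < e" by blast
  qed
  then show ?thesis by (rule Cauchy_convergent)
qed

section \<open>Order intervals in order continuous Banach lattices\<close>

text \<open>Domination by the norm of the positive part, instead of the norm, gives positivity for
  free: the dominating functional vanishes on the negative cone.\<close>

lemma exists_positive_norming_functional:
  fixes x :: "'a::banach_lattice"
  assumes "0 \<le> x"
  obtains h :: "'a \<Rightarrow>\<^sub>L real" where "\<And>z. 0 \<le> z \<Longrightarrow> 0 \<le> h z" "\<And>z. h z \<le> norm z"
    "h x = norm x"
proof -
  let ?p = "\<lambda>z::'a. norm (sup z 0)"
  have "sublinear ?p"
  proof (rule sublinearI)
    fix y z :: 'a
    have "?p (y + z) \<le> norm (sup y 0 + sup z 0)"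
      by (intro norm_mono_nonneg pos_part_add_le) simp
    also have "\<dots> \<le> ?p y + ?p z" by (rule norm_triangle_ineq)
    finally show "?p (y + z) \<le> ?p y + ?p z" .
  next
    fix c :: real and z :: 'a assume "c > 0"
    then show "?p (c *\<^sub>R z) \<le> c * ?p z" using sup_scaleR[of c z 0] by simp
  qed simp
  then obtain h where h: "linear h" "\<And>z. h z \<le> ?p z" "h x = ?p x"
    using exists_linear_below_sublinear_at by blast
  have le: "h z \<le> 1 * norm z" for z using h(2)[of z] norm_pos_part_le[of z] by simp
  then have "bounded_linear h" using linear_le_norm_imp_bounded(1)[OF h(1)] by blast
  moreover have "0 \<le> h z" if "0 \<le> z" for z
  proof -
    have "sup (- z) 0 = 0" using that by (simp add: sup_absorb2)
    then show ?thesis using h(2)[of "- z"] linear_neg[OF h(1), of z] by simp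
  qed
  moreover have "sup x 0 = x" using assms by (rule sup_absorb1)
  ultimately show ?thesis using that[of "Blinfun h"] h(3) le
    by (simp add: bounded_linear_Blinfun_apply)
qed

lemma blinfun_mono:
  fixes h :: "'a::banach_lattice \<Rightarrow>\<^sub>L real"
  assumes "\<And>z. 0 \<le> z \<Longrightarrow> 0 \<le> h z" "x \<le> y"
  shows "h x \<le> h y"
  using assms(1)[of "y - x"] assms(2) by (simp add: blinfun.diff_right)

text \<open>Finite stages of the supremum of the tail from \<open>n\<close> on; the full tail
  supremum is obtained only as a norm limit of these.\<close>

fun window_sup :: "(nat \<Rightarrow> 'a::lattice) \<Rightarrow> nat \<Rightarrow> nat \<Rightarrow> 'a" where
  "window_sup x n 0 = x n"
| "window_sup x n (Suc k) = sup (window_sup x n k) (x (n + Suc k))"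

lemma window_sup_Suc_le: "window_sup x (Suc n) k \<le> window_sup x n (Suc k)"
  by (induction k) (auto intro: le_supI1)

lemma window_sup_le: "(\<And>i. x i \<le> u) \<Longrightarrow> window_sup x n k \<le> u"
  by (induction k) auto

lemma window_sup_ge: "x n \<le> window_sup x n k"
  by (induction k) (auto intro: le_supI1)

text \<open>If no functional works, there are $x_n \in [0,u]$ of norm at least $\varepsilon$ and positive
  functionals $h_n$ with $h_n(x_n) = \|x_n\|$ and $h_m(x_n) < 2^{-n}$ for $m < n$. The decreasing
  sequence $y_n = \sup_{k \ge n} x_k$ converges in norm to some $y$; the bounds give $h_m(y) = 0$
  for all $m$, so $h_m (y_m - y) \ge \varepsilon$, although the $h_m$ are contractions.\<close>

theorem order_continuous_interval_functional:
  fixes u :: "'a::banach_lattice"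
  assumes oc: "order_continuous TYPE('a)" and e: "\<epsilon> > 0"
  obtains h :: "'a \<Rightarrow>\<^sub>L real" and \<delta> where "\<And>z. 0 \<le> z \<Longrightarrow> 0 \<le> h z" "\<delta> > 0"
    "\<And>x. 0 \<le> x \<Longrightarrow> x \<le> u \<Longrightarrow> h x < \<delta> \<Longrightarrow> norm x < \<epsilon>"
proof (rule ccontr)
  let ?pos = "\<lambda>h :: 'a \<Rightarrow>\<^sub>L real. \<forall>z. 0 \<le> z \<longrightarrow> 0 \<le> h z"
  assume "\<not> thesis"
  note witness = that
  have ex: "\<exists>x. 0 \<le> x \<and> x \<le> u \<and> h x < \<delta> \<and> \<epsilon> \<le> norm x" if h: "?pos h" and d: "\<delta> > 0" for h \<delta>
  proof (rule ccontr)
    assume "\<not> ?thesis"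
    then have thesis using h d by (intro witness[of h \<delta>]) (auto simp: not_le)
    with \<open>\<not> thesis\<close> show False ..
  qed
  define X where "X h \<delta> = (SOME x. 0 \<le> x \<and> x \<le> u \<and> h x < \<delta> \<and> \<epsilon> \<le> norm x)"
    for h :: "'a \<Rightarrow>\<^sub>L real" and \<delta>
  have X: "0 \<le> X h \<delta> \<and> X h \<delta> \<le> u \<and> h (X h \<delta>) < \<delta> \<and> \<epsilon> \<le> norm (X h \<delta>)"
    if "?pos h" "\<delta> > 0" for h \<delta>
    unfolding X_def by (rule someI_ex[OF ex[OF that]])
  define N where "N x = (SOME h :: 'a \<Rightarrow>\<^sub>L real. ?pos h \<and> (\<forall>z. h z \<le> norm z) \<and> h x = norm x)" for x
  have N: "?pos (N x) \<and> (\<forall>z. N x z \<le> norm z) \<and> N x x = norm x" if "0 \<le> x" for x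
    unfolding N_def by (rule someI_ex, rule exists_positive_norming_functional[OF that]) blast
  \<comment> \<open>\<open>G n\<close> is the sum of \<open>h 0\<close> up to
    \<open>h (n - 1)\<close>. By positivity, one smallness condition on \<open>G n (x n)\<close>
    bounds all earlier functionals at \<open>x n\<close> at once.\<close>
  define G where "G = rec_nat 0 (\<lambda>n g. g + N (X g ((1/2)^n)))"
  define x where "x n = X (G n) ((1/2)^n)" for n
  define h where "h n = N (x n)" for n
  have G: "G 0 = 0" "G (Suc n) = G n + h n" for n by (simp_all add: G_def x_def h_def)
  have posG: "?pos (G n)" for n
  proof (induction n)
    case (Suc n)
    have "0 \<le> x n" unfolding x_def using X[OF Suc, of "(1/2)^n"] by simp
    then show ?case using Suc N[of "x n"] by (simp add: G h_def blinfun.add_left)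
  qed (simp add: G)
  have x: "0 \<le> x n" "x n \<le> u" "G n (x n) < (1/2)^n" "\<epsilon> \<le> norm (x n)" for n
    unfolding x_def using X[OF posG, of "(1/2)^n"] by simp_all
  have h: "\<And>z. 0 \<le> z \<Longrightarrow> 0 \<le> h n z" "\<And>z. h n z \<le> norm z" "h n (x n) = norm (x n)" for n
    using N[OF x(1)] by (simp_all add: h_def)
  have hG: "h m z \<le> G n z" if "m < n" "0 \<le> z" for m n z
    using that
  proof (induction n)
    case (Suc n)
    then show ?case using h(1)[of z n] posG
      by (cases "m = n") (auto simp: G blinfun.add_left)
  qed simp
  have hx: "h m (x n) \<le> (1/2)^n" if "m < n" for m n
    using hG[OF that x(1)] x(3)[of n] by (rule order_trans[OF _ less_imp_le])
  \<comment> \<open>The bound is the geometric sum of \<open>(1/2)^i\<close> for \<open>i\<close>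
    from \<open>n\<close> to \<open>n + k\<close>, in the closed form that makes the induction
    exact.\<close>
  have hs: "h m (window_sup x n k) \<le> 2 * (1/2)^n - (1/2)^(n+k)" if "m < n" for m n k
  proof (induction k)
    case (Suc k)
    have "window_sup x n (Suc k) \<le> window_sup x n k + x (n + Suc k)"
      using x(1) order_trans[OF x(1) window_sup_ge] by (simp add: add_increasing add_increasing2)
    then have "h m (window_sup x n (Suc k)) \<le> h m (window_sup x n k) + h m (x (n + Suc k))"
      using blinfun_mono[OF h(1)] by (metis blinfun.add_right)
    then show ?case using Suc hx[of m "n + Suc k"] that by simp
  qed (use hx[OF that] in simp)
  have "convergent (window_sup x n)" for n
    by (rule order_continuous_incseq_Cauchy[OF oc _ window_sup_le[OF x(2)]]) (simp add: incseq_SucI)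
  then obtain y where y: "\<And>n. window_sup x n \<longlonglongrightarrow> y n" unfolding convergent_def by metis
  have xy: "x n \<le> y n" for n by (rule lim_mono_lattice[OF tendsto_const y window_sup_ge])
  have ydec: "y (Suc n) \<le> y n" for n
    by (rule lim_mono_lattice[OF y LIMSEQ_Suc[OF y] window_sup_Suc_le])
  \<comment> \<open>The tail suprema decrease and stay nonnegative, so their negatives increase
    below 0.\<close>
  have "convergent (\<lambda>n. - y n)"
    by (rule order_continuous_incseq_Cauchy[OF oc, of _ 0])
      (use ydec order_trans[OF x(1) xy] in \<open>auto intro: incseq_SucI\<close>)
  then have "convergent y" by (rule iffD2[OF convergent_minus_iff])
  then obtain Y where Y: "y \<longlonglongrightarrow> Y" unfolding convergent_def by blast
  have hy: "h m (y n) \<le> 2 * (1/2)^n" if "m < n" for m n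
  proof (rule LIMSEQ_le_const2)
    show "(\<lambda>k. h m (window_sup x n k)) \<longlonglongrightarrow> h m (y n)" by (intro tendsto_intros y)
    show "\<exists>K. \<forall>k\<ge>K. h m (window_sup x n k) \<le> 2 * (1/2)^n"
    proof (intro exI allI impI)
      fix k
      have "(0::real) \<le> (1/2)^(n+k)" by simp
      with hs[OF that, of k] show "h m (window_sup x n k) \<le> 2 * (1/2)^n" by linarith
    qed
  qed
  have hY: "h m Y \<le> 0" for m
  proof (rule LIMSEQ_le)
    show "(\<lambda>n. h m (y n)) \<longlonglongrightarrow> h m Y" by (intro tendsto_intros Y)
    have "(\<lambda>n. 2 * (1/2)^n :: real) \<longlonglongrightarrow> 2 * 0" by (intro tendsto_intros LIMSEQ_power_zero) simp
    then show "(\<lambda>n. 2 * (1/2)^n :: real) \<longlonglongrightarrow> 0" by simp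
    show "\<exists>K. \<forall>n\<ge>K. h m (y n) \<le> 2 * (1/2)^n"
      using hy[of m] by (intro exI[of _ "Suc m"]) auto
  qed
  obtain m where "norm (y m - Y) < \<epsilon>" using LIMSEQ_D[OF Y e] by blast
  moreover have "\<epsilon> \<le> norm (y m - Y)"
  proof -
    have "\<epsilon> \<le> h m (x m)" using x(4) h(3) by simp
    also have "\<dots> \<le> h m (y m)" by (rule blinfun_mono[OF h(1) xy])
    also have "\<dots> \<le> h m (y m - Y)" using hY[of m] by (simp add: blinfun.diff_right)
    also have "\<dots> \<le> norm (y m - Y)" by (rule h(2))
    finally show ?thesis .
  qed
  ultimately show False by simp
qed

text \<open>For real functions one argues pointwise: at the last index \<open>j\<close> with
  \<open>Y \<le> A j\<close>, also \<open>Y \<le> B j\<close>. Distributivity replaces points by the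
  invariant that \<open>Y\<close> is below the supremum of \<open>A k\<close> and the first
  \<open>k\<close> terms of the sum.\<close>

lemma lattice_staircase:
  fixes Y :: "'a::lattice_ab_group_add"
  assumes "Y \<le> A 0" "\<And>j. j < n \<Longrightarrow> Y \<le> sup (A (Suc j)) (B j)" "Y \<le> B n"
    "\<And>j. 0 \<le> A j" "\<And>j. 0 \<le> B j"
  shows "Y \<le> (\<Sum>j\<le>n. inf (A j) (B j))"
proof -
  let ?S = "\<lambda>k. \<Sum>j<k. inf (A j) (B j)"
  have S0: "0 \<le> ?S k" for k using assms(4,5) by (intro sum_nonneg) simp
  \<comment> \<open>Used with \<open>a = A (Suc k)\<close> along the staircase and with
    \<open>a = 0\<close> at its end.\<close>
  have step: "inf (sup (?S k) (A k)) (sup a (B k)) \<le> sup a (?S (Suc k))" for a k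
  proof -
    have "?S k \<le> ?S (Suc k)" "inf (A k) (B k) \<le> ?S (Suc k)"
      using S0[of k] assms(4,5) by (simp_all add: add_increasing add_increasing2)
    moreover have "inf (sup (?S k) (A k)) (sup a (B k)) \<le> sup a (sup (?S k) (inf (A k) (B k)))"
      by (simp add: inf_sup_distrib1 inf_sup_distrib2 le_supI1 le_supI2 le_infI1 le_infI2)
    ultimately show ?thesis
      by (meson order_trans sup_least sup_mono order_refl)
  qed
  have "Y \<le> sup (?S k) (A k)" if "k \<le> n" for k
    using that
  proof (induction k)
    case (Suc k)
    then have "Y \<le> inf (sup (?S k) (A k)) (sup (A (Suc k)) (B k))" using assms(2) by simp
    also have "\<dots> \<le> sup (A (Suc k)) (?S (Suc k))" by (rule step)
    finally show ?case by (simp add: sup_commute)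
  qed (use assms(1) in \<open>simp add: le_supI2\<close>)
  then have "Y \<le> inf (sup (?S n) (A n)) (sup 0 (B n))"
    using assms(3) by (simp add: le_supI2)
  also have "\<dots> \<le> sup 0 (?S (Suc n))" by (rule step)
  also have "\<dots> = ?S (Suc n)" using S0 by (rule sup_absorb2)
  finally show ?thesis by (simp only: lessThan_Suc_atMost)
qed

text \<open>Quantitative concavity of truncation at \<open>t\<close>. After translation by
  \<open>t\<close> it reduces to comparing positive and negative parts: where \<open>a\<close> is
  above \<open>t\<close> and \<open>b\<close> below it, averaging cancels part of the excess before
  truncation discards it.\<close>

lemma inf_midpoint_gain:
  fixes a b t :: "'a::banach_lattice"
  shows "inf a t + inf b t + inf (sup (a - t) 0) (sup (t - b) 0) \<le> 2 *\<^sub>R inf ((1/2) *\<^sub>R (a + b)) t"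
proof -
  define c d where "c = a - t" and "d = b - t"
  define g where "g = inf (sup c 0) (sup (- d) 0)"
  have g: "g \<le> sup c 0" "g \<le> sup (- d) 0" by (simp_all add: g_def)
  have c: "sup c 0 + inf c 0 = c" and d: "sup d 0 + inf d 0 = d"
    using add_eq_inf_sup[of c 0] add_eq_inf_sup[of d 0] by simp_all
  have dn: "sup (- d) 0 = - inf d 0" by (simp add: neg_inf_eq_sup)
  have "inf c 0 + inf d 0 + g \<le> inf (c + d) 0"
  proof (rule inf_greatest)
    have "inf c 0 + inf d 0 + g \<le> inf c 0 + d + sup c 0"
      by (intro add_mono g) simp_all
    also have "\<dots> = c + d" using c by (metis add.assoc add.commute)
    finally show "inf c 0 + inf d 0 + g \<le> c + d" .
    have "g + inf d 0 \<le> 0" using g(2) unfolding dn by (simp only: le_eq_neg)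
    then have "inf c 0 + (g + inf d 0) \<le> 0 + 0" by (intro add_mono) simp_all
    then show "inf c 0 + inf d 0 + g \<le> 0" by (simp only: add_ac add_0)
  qed
  then have "(inf c 0 + t) + (inf d 0 + t) + g \<le> inf (c + d) 0 + 2 *\<^sub>R t"
    by (simp add: scaleR_2 algebra_simps)
  moreover have "inf c 0 + t = inf a t" "inf d 0 + t = inf b t"
    by (simp_all add: c_def d_def add_inf_distrib_right)
  moreover have "inf (c + d) 0 + 2 *\<^sub>R t = inf (a + b) (2 *\<^sub>R t)"
    by (simp add: c_def d_def add_inf_distrib_right scaleR_2)
  moreover have "inf (a + b) (2 *\<^sub>R t) = 2 *\<^sub>R inf ((1/2) *\<^sub>R (a + b)) t"
    using inf_scaleR[of 2 "(1/2) *\<^sub>R (a + b)" t] by simp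
  ultimately show ?thesis by (simp add: g_def c_def d_def)
qed

text \<open>\<open>Y\<close> retains half of what \<open>a - b\<close> has above
  \<open>t *\<^sub>R u\<close>, cut off where the moduli outgrow \<open>N *\<^sub>R u\<close>. The
  three terms on the right pay for the threshold, for the retained part, and for the cutoff, where
  \<open>u\<close> is dominated by the moduli divided by \<open>N\<close>.\<close>

lemma truncation_estimate:
  fixes a b u :: "'a::banach_lattice"
  assumes u: "0 \<le> u" and t: "0 \<le> t" and N: "1 \<le> N"
  defines "Y \<equiv> inf ((1/2) *\<^sub>R sup (a - b - t *\<^sub>R u) 0) (sup (N *\<^sub>R u - (labs a + labs b)) 0)"
  shows "inf (sup (a - b) 0) u \<le> t *\<^sub>R u + 2 *\<^sub>R inf Y u + (1/N) *\<^sub>R (labs a + labs b)"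
proof -
  define v where "v = sup (a - b - t *\<^sub>R u) 0"
  define c where "c = (1/N) *\<^sub>R (labs a + labs b)"
  define r where "r = sup (u - c) 0"
  have c: "0 \<le> c" using N by (simp add: c_def scaleR_nonneg_nonneg)
  have tu: "0 \<le> t *\<^sub>R u" using t u by (rule scaleR_nonneg_nonneg)
  have v0: "0 \<le> v" and r0: "0 \<le> r" by (simp_all add: v_def r_def)
  have ru: "r \<le> u" using c u by (simp add: r_def diff_le_eq)
  have rN: "r \<le> sup (N *\<^sub>R u - (labs a + labs b)) 0"
  proof -
    have "1 *\<^sub>R r \<le> N *\<^sub>R r" using N r0 by (intro scaleR_right_mono)
    also have "N *\<^sub>R r = sup (N *\<^sub>R (u - c)) (N *\<^sub>R 0)"
      unfolding r_def using N by (intro sup_scaleR[symmetric]) simp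
    also have "N *\<^sub>R (u - c) = N *\<^sub>R u - (labs a + labs b)"
      using N by (simp add: c_def scaleR_diff_right)
    finally show ?thesis by simp
  qed
  have vY: "inf v r \<le> 2 *\<^sub>R inf Y u"
  proof -
    have "inf (2 *\<^sub>R ((1/2) *\<^sub>R v)) r \<le> 2 *\<^sub>R inf ((1/2) *\<^sub>R v) r"
      using v0 r0 by (intro inf_scaleR_left_le) (simp_all add: scaleR_nonneg_nonneg)
    also have "\<dots> \<le> 2 *\<^sub>R inf Y u"
      using ru rN by (intro scaleR_left_mono) (auto simp: Y_def v_def intro: le_infI1 le_infI2)
    finally show ?thesis by simp
  qed
  have "sup (a - b) 0 \<le> v + t *\<^sub>R u"
    using tu by (simp add: v_def add_sup_distrib_right le_supI2)
  then have "inf (sup (a - b) 0) u \<le> inf u (v + t *\<^sub>R u)" by (simp add: le_infI1)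
  also have "\<dots> \<le> inf u v + t *\<^sub>R u" by (rule inf_add_le[OF tu])
  also have "inf u v \<le> inf v (r + c)"
  proof -
    have "u - c \<le> r" by (simp add: r_def)
    then have "u \<le> r + c" by (simp only: diff_le_eq)
    then show ?thesis by (simp add: le_infI1)
  qed
  also have "inf v (r + c) \<le> inf v r + c" by (rule inf_add_le[OF c])
  also have "\<dots> \<le> 2 *\<^sub>R inf Y u + c" by (intro add_right_mono vY)
  finally show ?thesis by (simp add: c_def algebra_simps)
qed

text \<open>The levels \<open>s j\<close> run from \<open>- (L * t)\<close> to \<open>L * t\<close>
  times \<open>u\<close> in steps of \<open>t\<close>. The cutoff in the second argument of the
  infimum provides the two ends of the staircase, since there the extreme levels enclose
  \<open>a\<close> and \<open>b\<close>.\<close>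

lemma truncation_le_staircase:
  fixes a b u :: "'a::banach_lattice" and L :: nat and t :: real
  defines "s \<equiv> \<lambda>j::nat. ((real j - real L) * t) *\<^sub>R u"
  shows "inf ((1/2) *\<^sub>R sup (a - b - t *\<^sub>R u) 0) (sup ((L * t) *\<^sub>R u - (labs a + labs b)) 0)
    \<le> (\<Sum>j\<le>2*L. inf (sup (a - s j) 0) (sup (s j - b) 0))" (is "?Y \<le> _")
proof (rule lattice_staircase)
  have "(L * t) *\<^sub>R u - (labs a + labs b) \<le> a - s 0"
  proof -
    have "- a \<le> labs a + labs b" by (rule order_trans[OF labs_ge(2)]) simp
    then have "- (labs a + labs b) \<le> a" by (simp only: minus_le_iff)
    then have "(L * t) *\<^sub>R u + - (labs a + labs b) \<le> (L * t) *\<^sub>R u + a" by (rule add_left_mono)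
    moreover have "a - s 0 = (L * t) *\<^sub>R u + a" by (simp add: s_def)
    ultimately show ?thesis by (simp only: diff_conv_add_uminus[of "(L * t) *\<^sub>R u"])
  qed
  then show "?Y \<le> sup (a - s 0) 0" by (intro le_infI2 sup_mono) auto
  have "(L * t) *\<^sub>R u - (labs a + labs b) \<le> s (2*L) - b"
  proof -
    have "b \<le> labs a + labs b" by (rule order_trans[OF labs_ge(1)]) simp
    then have "(L * t) *\<^sub>R u - (labs a + labs b) \<le> (L * t) *\<^sub>R u - b" by (rule diff_left_mono)
    moreover have "s (2*L) = (L * t) *\<^sub>R u" by (simp add: s_def)
    ultimately show ?thesis by (simp only:)
  qed
  then show "?Y \<le> sup (s (2*L) - b) 0" by (intro le_infI2 sup_mono) auto
  fix j :: nat
  let ?m = "sup (sup (a - s (Suc j)) 0) (sup (s j - b) 0)"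
  \<comment> \<open>For neighbouring levels the two gaps add up to
    \<open>a - b - t *\<^sub>R u\<close>, so their supremum is at least half of it; this is the
    origin of the factor 1/2.\<close>
  have "(a - s (Suc j)) + (s j - b) \<le> ?m + ?m"
    by (intro add_mono) (simp_all add: le_supI1 le_supI2)
  moreover have "(a - s (Suc j)) + (s j - b) = a - b - t *\<^sub>R u"
    by (simp add: s_def algebra_simps)
  ultimately have "sup (a - b - t *\<^sub>R u) 0 \<le> 2 *\<^sub>R ?m"
    by (simp add: scaleR_2 le_supI1)
  then have "(1/2) *\<^sub>R sup (a - b - t *\<^sub>R u) 0 \<le> (1/2) *\<^sub>R (2 *\<^sub>R ?m)"
    by (intro scaleR_left_mono) auto
  then show "?Y \<le> ?m" by (simp add: le_infI1)
qed simp_all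

section \<open>A uniformly concave functional\<close>

lemma labs_le_parts: "labs x \<le> sup x 0 + sup (- x) (0::'a::banach_lattice)"
  by (rule labs_leI) (simp_all add: add_increasing add_increasing2)

lemma parts_disjoint: "inf (sup x 0) (sup (- x) 0) = (0::'a::banach_lattice)"
proof -
  have p: "sup x 0 = x + sup (- x) 0"
    using pos_part_diff_neg_part[of x] by (simp only: diff_eq_eq add.commute)
  have "inf (sup x 0) (sup (- x) 0) = inf (x + sup (- x) 0) (0 + sup (- x) 0)"
    by (subst p) simp
  also have "\<dots> = inf x 0 + sup (- x) 0" by (rule add_inf_distrib_right[symmetric])
  also have "\<dots> = inf x 0 + - inf x 0" by (simp only: neg_inf_eq_sup minus_zero)
  finally show ?thesis by (simp only: add.right_inverse)
qed

text \<open>The midpoint gap of \<open>J\<close> bounds \<open>h\<close> of the staircase, hence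
  \<open>h (inf Y u)\<close>. Since \<open>inf Y u\<close> lies in the order interval below
  \<open>u\<close>, the choice of \<open>h\<close> turns this into smallness in norm. The gap bound
  \<open>\<gamma>\<close> is the \<open>\<delta>\<close> belonging to \<open>h\<close>.\<close>

theorem exists_uniformly_concave_functional:
  fixes u :: "'a::banach_lattice"
  assumes oc: "order_continuous TYPE('a)" and u: "0 \<le> u" and e: "\<epsilon> > 0" and M: "0 \<le> M"
  obtains J :: "'a \<Rightarrow> real" and B \<gamma> where "\<gamma> > 0" "\<And>x. norm x \<le> M \<Longrightarrow> \<bar>J x\<bar> \<le> B"
    "\<And>a b. norm a \<le> M \<Longrightarrow> norm b \<le> M \<Longrightarrow> 2 * J ((1/2) *\<^sub>R (a + b)) < J a + J b + \<gamma>
      \<Longrightarrow> norm (inf (labs (a - b)) u) < \<epsilon>"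
proof -
  \<comment> \<open>The truncation estimate doubles \<open>inf Y u\<close>, so
    \<open>\<epsilon>/16\<close> yields \<open>\<epsilon>/8\<close>. Its three terms each get
    \<open>\<epsilon>/8\<close>, and their sum stays below the \<open>\<epsilon>/2\<close> reserved
    for each sign of \<open>a - b\<close>.\<close>
  obtain h :: "'a \<Rightarrow>\<^sub>L real" and \<delta> where h: "\<And>z. 0 \<le> z \<Longrightarrow> 0 \<le> h z" and d: "\<delta> > 0"
    and hd: "\<And>x. 0 \<le> x \<Longrightarrow> x \<le> u \<Longrightarrow> h x < \<delta> \<Longrightarrow> norm x < \<epsilon> / 16"
    using order_continuous_interval_functional[OF oc, of "\<epsilon>/16" u] e by auto
  define t where "t = \<epsilon> / (8 * (norm u + 1))"
  have nu: "norm u + 1 > 0" by (simp add: add_nonneg_pos)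
  have t: "t > 0" using e nu by (simp add: t_def)
  have tu: "t * norm u \<le> \<epsilon> / 8"
  proof -
    have "t * norm u \<le> t * (norm u + 1)" using t by simp
    also have "\<dots> = \<epsilon> / 8" using nu by (simp add: t_def field_simps)
    finally show ?thesis .
  qed
  \<comment> \<open>\<open>L\<close> is large enough that \<open>N = L * t\<close> is at least 1, as
    the truncation estimate demands, and that the moduli, of total norm at most
    \<open>2 * M\<close>, contribute at most \<open>\<epsilon>/8\<close> after division by
    \<open>N\<close>.\<close>
  obtain L :: nat where L: "max 1 (16 * M / \<epsilon>) / t \<le> L" using real_arch_simple by blast
  define N where "N = L * t"
  have "max 1 (16 * M / \<epsilon>) \<le> N" using L t by (simp add: N_def pos_divide_le_eq)
  then have N: "1 \<le> N" "16 * M \<le> N * \<epsilon>" using e by (simp_all add: pos_divide_le_eq)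
  have MN: "2 * M / N \<le> \<epsilon> / 8" using N by (simp add: field_simps)
  define s where "s = (\<lambda>j::nat. ((real j - real L) * t) *\<^sub>R u)"
  define J where "J x = (\<Sum>j\<le>2*L. h (inf x (s j)))" for x
  have half: "norm (inf (sup (a - b) 0) u) < \<epsilon> / 2"
    if a: "norm a \<le> M" and b: "norm b \<le> M"
      and J: "2 * J ((1/2) *\<^sub>R (a + b)) < J a + J b + \<delta>" for a b
  proof -
    define Y where
      "Y = inf ((1/2) *\<^sub>R sup (a - b - t *\<^sub>R u) 0) (sup (N *\<^sub>R u - (labs a + labs b)) 0)"
    define g where "g j = inf (sup (a - s j) 0) (sup (s j - b) 0)" for j
    have Y0: "0 \<le> Y" by (simp add: Y_def scaleR_nonneg_nonneg)
    have Yg: "Y \<le> (\<Sum>j\<le>2*L. g j)"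
      using truncation_le_staircase[where a=a and b=b and u=u and t=t and L=L]
      by (simp add: Y_def N_def g_def s_def)
    have "J a + J b + (\<Sum>j\<le>2*L. h (g j)) \<le> 2 * J ((1/2) *\<^sub>R (a + b))"
    proof -
      have "h (inf a (s j)) + h (inf b (s j)) + h (g j) \<le> 2 * h (inf ((1/2) *\<^sub>R (a + b)) (s j))" for j
        using blinfun_mono[OF h inf_midpoint_gain[of a "s j" b]]
        by (simp add: blinfun.add_right blinfun.scaleR_right g_def)
      then have "(\<Sum>j\<le>2*L. h (inf a (s j)) + h (inf b (s j)) + h (g j))
          \<le> (\<Sum>j\<le>2*L. 2 * h (inf ((1/2) *\<^sub>R (a + b)) (s j)))" by (rule sum_mono)
      then show ?thesis by (simp add: J_def sum.distrib sum_distrib_left)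
    qed
    with J have "(\<Sum>j\<le>2*L. h (g j)) < \<delta>" by simp
    moreover have "h (inf Y u) \<le> h (\<Sum>j\<le>2*L. g j)"
      by (intro blinfun_mono[OF h] le_infI1 Yg)
    ultimately have "h (inf Y u) < \<delta>" by (simp add: blinfun.sum_right)
    then have nY: "norm (inf Y u) < \<epsilon> / 16" using Y0 u by (intro hd) simp_all
    have "norm (inf (sup (a - b) 0) u)
        \<le> norm (t *\<^sub>R u + 2 *\<^sub>R inf Y u + (1/N) *\<^sub>R (labs a + labs b))"
      using truncation_estimate[OF u less_imp_le[OF t] N(1), of a b] u
      by (intro norm_mono_nonneg) (simp_all add: Y_def)
    also have "\<dots> \<le> norm (t *\<^sub>R u) + norm (2 *\<^sub>R inf Y u) + norm ((1/N) *\<^sub>R (labs a + labs b))"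
      by (intro norm_triangle_le add_right_mono norm_triangle_ineq)
    also have "norm (t *\<^sub>R u) \<le> \<epsilon> / 8" using tu t by simp
    also have "norm (2 *\<^sub>R inf Y u) \<le> \<epsilon> / 8" using nY by simp
    also have "norm ((1/N) *\<^sub>R (labs a + labs b)) \<le> \<epsilon> / 8"
    proof -
      have "norm (labs a + labs b) \<le> 2 * M"
        using norm_triangle_ineq[of "labs a" "labs b"] a b by simp
      then have "norm (labs a + labs b) / N \<le> 2 * M / N" using N(1) by (simp add: divide_right_mono)
      moreover have "norm ((1/N) *\<^sub>R (labs a + labs b)) = norm (labs a + labs b) / N"
        using N(1) by simp
      ultimately show ?thesis using MN by linarith
    qed
    finally show ?thesis using e by simp
  qed
  show ?thesis
  proof (rule that[OF d])
    show "\<bar>J x\<bar> \<le> (\<Sum>j\<le>2*L. norm h * (M + norm (s j)))" if "norm x \<le> M" for x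
    proof -
      have "\<bar>h (inf x (s j))\<bar> \<le> norm h * (M + norm (s j))" for j
      proof -
        have "norm (inf x (s j)) \<le> norm (labs x + labs (s j))"
          by (intro labs_le_imp_norm_le labs_inf_le)
        also have "\<dots> \<le> M + norm (s j)"
          using norm_triangle_ineq[of "labs x" "labs (s j)"] that by simp
        finally have "norm h * norm (inf x (s j)) \<le> norm h * (M + norm (s j))"
          by (rule mult_left_mono) simp
        with norm_blinfun[of h "inf x (s j)"] show ?thesis by simp
      qed
      then show ?thesis unfolding J_def by (intro order_trans[OF sum_abs] sum_mono)
    qed
    fix a b assume ab: "norm a \<le> M" "norm b \<le> M" "2 * J ((1/2) *\<^sub>R (a + b)) < J a + J b + \<delta>"
    have "inf (labs (a - b)) u \<le> inf (sup (a - b) 0 + sup (b - a) 0) u"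
      using labs_le_parts[of "a - b"] by (intro inf_mono) simp_all
    also have "\<dots> \<le> inf (sup (a - b) 0) u + inf (sup (b - a) 0) u"
      using u by (intro inf_add_le_add_inf) simp_all
    finally have "norm (inf (labs (a - b)) u) \<le> norm (inf (sup (a - b) 0) u + inf (sup (b - a) 0) u)"
      using u by (intro norm_mono_nonneg) simp_all
    also have "\<dots> \<le> norm (inf (sup (a - b) 0) u) + norm (inf (sup (b - a) 0) u)"
      by (rule norm_triangle_ineq)
    also have "\<dots> < \<epsilon> / 2 + \<epsilon> / 2"
      using ab by (intro add_strict_mono half) (simp_all add: add.commute)
    finally show "norm (inf (labs (a - b)) u) < \<epsilon>" by simp
  qed
qed

text \<open>All approximate maximizers, over a small member of the family, of the functional from
  \<open>exists_uniformly_concave_functional\<close> are close to each other.\<close>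

theorem directed_convex_concentration:
  fixes \<C> :: "'a::banach_lattice set set"
  assumes oc: "order_continuous TYPE('a)"
    and ne: "\<And>C. C \<in> \<C> \<Longrightarrow> C \<noteq> {}" and cv: "\<And>C. C \<in> \<C> \<Longrightarrow> convex C"
    and bd: "\<And>C x. C \<in> \<C> \<Longrightarrow> x \<in> C \<Longrightarrow> norm x \<le> M"
    and dir: "\<And>C D. C \<in> \<C> \<Longrightarrow> D \<in> \<C> \<Longrightarrow> \<exists>E\<in>\<C>. E \<subseteq> C \<inter> D"
    and u: "0 \<le> u" and e: "\<epsilon> > 0" and K: "K \<in> \<C>"
    and H: "\<And>x y. x \<in> K \<Longrightarrow> y \<in> K \<Longrightarrow> norm (inf (labs (x - y)) u) < \<epsilon> \<Longrightarrow> norm (x - y) < \<eta>"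
  obtains x0 where "\<And>C. C \<in> \<C> \<Longrightarrow> \<exists>x\<in>C. norm (x - x0) < \<eta>"
proof -
  have M: "0 \<le> M" using ne[OF K] bd[OF K] norm_ge_zero order_trans by blast
  obtain J :: "'a \<Rightarrow> real" and B \<gamma> where g: "\<gamma> > 0" and JB: "\<And>x::'a. norm x \<le> M \<Longrightarrow> \<bar>J x\<bar> \<le> B"
    and J: "\<And>a b. norm a \<le> M \<Longrightarrow> norm b \<le> M \<Longrightarrow> 2 * J ((1/2) *\<^sub>R (a + b)) < J a + J b + \<gamma>
      \<Longrightarrow> norm (inf (labs (a - b)) u) < \<epsilon>"
    by (rule exists_uniformly_concave_functional[OF oc u e M]) (rule that)
  define S where "S C = (SUP x\<in>C. J x)" for C
  have bda: "bdd_above (J ` C)" if "C \<in> \<C>" for C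
  proof (rule bdd_aboveI2)
    show "J x \<le> B" if "x \<in> C" for x using JB[OF bd[OF \<open>C \<in> \<C>\<close> that]] by simp
  qed
  have up: "J x \<le> S C" if "C \<in> \<C>" "x \<in> C" for C x
    unfolding S_def by (rule cSUP_upper[OF that(2) bda[OF that(1)]])
  have bS: "- B \<le> S C" if C: "C \<in> \<C>" for C
  proof -
    obtain x where x: "x \<in> C" using ne[OF C] by blast
    show ?thesis using up[OF C x] JB[OF bd[OF C x]] by simp
  qed
  define c where "c = (INF C\<in>\<C>. S C)"
  have low: "c \<le> S C" if "C \<in> \<C>" for C
    unfolding c_def by (rule cINF_lower[OF bdd_belowI2[OF bS] that])
  \<comment> \<open>Two points with \<open>J\<close> above \<open>c - \<gamma>/4\<close> and a
    midpoint with \<open>J\<close> below \<open>c + \<gamma>/4\<close> have a gap less than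
    \<open>\<gamma>\<close>; hence the quarters.\<close>
  have "\<exists>C\<in>\<C>. S C < c + \<gamma> / 4"
  proof (rule ccontr)
    assume "\<not> ?thesis"
    then have "c + \<gamma> / 4 \<le> c" using K unfolding c_def[symmetric]
      by (subst (2) c_def, intro cINF_greatest) (auto simp: not_less)
    with g show False by simp
  qed
  then obtain C0 where C0: "C0 \<in> \<C>" "S C0 < c + \<gamma> / 4" by blast
  obtain C2 where C2: "C2 \<in> \<C>" "C2 \<subseteq> C0 \<inter> K" using dir[OF C0(1) K] by blast
  have near: "\<exists>x\<in>C. c - \<gamma> / 4 < J x" if C: "C \<in> \<C>" for C
  proof -
    have "c - \<gamma> / 4 < S C" using low[OF C] g by simp
    then show ?thesis unfolding S_def using less_cSUP_iff[OF ne[OF C] bda[OF C]] by simp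
  qed
  obtain x0 where x0: "x0 \<in> C2" "c - \<gamma> / 4 < J x0" using near[OF C2(1)] by blast
  show ?thesis
  proof (rule that)
    fix C assume "C \<in> \<C>"
    \<comment> \<open>Inside \<open>C2\<close>, the points \<open>x\<close> and \<open>x0\<close>
      share one convex set, where \<open>C0\<close> caps \<open>J\<close> at the midpoint and
      \<open>K\<close> makes \<open>H\<close> applicable.\<close>
    then obtain C3 where C3: "C3 \<in> \<C>" "C3 \<subseteq> C \<inter> C2" using dir[OF _ C2(1)] by blast
    obtain x where x: "x \<in> C3" "c - \<gamma> / 4 < J x" using near[OF C3(1)] by blast
    have xC2: "x \<in> C2" using x(1) C3(2) by blast
    have "(1/2) *\<^sub>R x + (1/2) *\<^sub>R x0 \<in> C2"
      by (rule convexD[OF cv[OF C2(1)] xC2 x0(1)]) simp_all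
    then have "(1/2) *\<^sub>R (x + x0) \<in> C0" using C2(2) by (auto simp: scaleR_add_right)
    then have "J ((1/2) *\<^sub>R (x + x0)) < c + \<gamma> / 4" by (intro le_less_trans[OF up[OF C0(1)] C0(2)])
    then have "norm (inf (labs (x - x0)) u) < \<epsilon>"
      using x(2) x0(2) bd[OF C2(1) xC2] bd[OF C2(1) x0(1)] by (intro J) simp_all
    then have "norm (x - x0) < \<eta>" using xC2 x0(1) C2(2) by (intro H) auto
    with x(1) C3(2) show "\<exists>x\<in>C. norm (x - x0) < \<eta>" by blast
  qed
qed

section \<open>Almost disjoint sequences\<close>

text \<open>Kadec-Pelczynski disjointification. From the modulus of \<open>z n\<close> a barrier
  \<open>v n\<close> is removed: \<open>4^n\<close> times the sum of the earlier moduli, which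
  separates it from earlier terms, plus \<open>(1/2)^n *\<^sub>R w\<close>, which separates it from
  later ones because \<open>w\<close> dominates \<open>(1/2)^m *\<^sub>R y m\<close> for every
  \<open>m\<close>.\<close>

lemma almost_disjoint_perturbation:
  fixes z :: "nat \<Rightarrow> 'a::banach_lattice"
  assumes bd: "\<And>n. norm (z n) \<le> R"
    and lim: "(\<lambda>n. norm (inf (labs (z n)) (4^n *\<^sub>R (\<Sum>i<n. labs (z i))))) \<longlonglongrightarrow> 0"
  obtains f where "disjoint_seq f" "(\<lambda>n. norm (z n - f n)) \<longlonglongrightarrow> 0"
proof -
  define y where "y i = labs (z i)" for i
  define S where "S n = (\<Sum>i<n. y i)" for n
  define T where "T n = (\<Sum>i<n. (1/2)^i *\<^sub>R y i)" for n
  have y0: "0 \<le> y i" for i by (simp add: y_def)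
  have "summable (\<lambda>i. norm ((1/2)^i *\<^sub>R y i))"
  proof (rule summable_comparison_test')
    show "summable (\<lambda>i. (1/2)^i * R)" by (intro summable_mult2 summable_geometric) simp
    show "norm (norm ((1/2)^i *\<^sub>R y i)) \<le> (1/2)^i * R" if "0 \<le> i" for i
      using bd[of i] by (simp add: y_def mult_left_mono)
  qed
  then have "summable (\<lambda>i. (1/2)^i *\<^sub>R y i)" by (rule summable_norm_cancel)
  then obtain w where w: "T \<longlonglongrightarrow> w" unfolding T_def summable_def sums_def by blast
  have yw: "(1/2)^m *\<^sub>R y m \<le> w" for m
  proof -
    have "0 \<le> w - (1/2)^m *\<^sub>R y m"
    proof (rule nonneg_lim)
      show "(\<lambda>n. T n - (1/2)^m *\<^sub>R y m) \<longlonglongrightarrow> w - (1/2)^m *\<^sub>R y m" by (intro tendsto_intros w)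
      show "\<forall>\<^sub>F n in sequentially. 0 \<le> T n - (1/2)^m *\<^sub>R y m"
        using eventually_gt_at_top[of m]
      proof eventually_elim
        case (elim n)
        have "(\<Sum>i\<in>{m}. (1/2)^i *\<^sub>R y i) \<le> T n"
          unfolding T_def using elim y0 by (intro sum_mono2) (auto simp: scaleR_nonneg_nonneg)
        then show ?case by simp
      qed
    qed
    then show ?thesis by simp
  qed
  have w0: "0 \<le> w" using order_trans[OF _ yw[of 0]] y0[of 0] by simp
  have S0: "0 \<le> S n" for n unfolding S_def by (intro sum_nonneg y0)
  define v where "v n = 4^n *\<^sub>R S n + (1/2)^n *\<^sub>R w" for n
  have v0: "0 \<le> v n" for n
    unfolding v_def using S0 w0 by (intro add_nonneg_nonneg scaleR_nonneg_nonneg) simp_all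
  define g where "g n = sup (y n - v n) 0" for n
  have g0: "0 \<le> g n" for n by (simp add: g_def)
  \<comment> \<open>The barrier is removed from the positive and negative parts separately, which
    keeps the signs of \<open>z n\<close>.\<close>
  define f where "f n = sup (sup (z n) 0 - v n) 0 - sup (sup (- z n) 0 - v n) 0" for n
  have fg: "labs (f n) \<le> 2 *\<^sub>R g n" for n
  proof -
    have *: "labs (sup (sup x 0 - v n) 0) \<le> g n" if "x \<le> y n" for x
      using that y0[of n] by (auto simp: labs_of_nonneg g_def intro!: le_supI1 diff_right_mono)
    have "labs (f n) \<le> labs (sup (sup (z n) 0 - v n) 0) + labs (- sup (sup (- z n) 0 - v n) 0)"
      unfolding f_def using labs_triangle by (metis diff_conv_add_uminus)
    also have "\<dots> \<le> g n + g n"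
      unfolding labs_uminus using labs_ge[of "z n"] by (intro add_mono *) (simp_all add: y_def)
    finally show ?thesis by (simp add: scaleR_2)
  qed
  have gg: "inf (g n) (g m) = 0" if nm: "n < m" for n m
  proof -
    \<comment> \<open>With this \<open>c\<close>, \<open>v n\<close> is at least \<open>y m\<close>
      divided by \<open>c\<close>, and \<open>v m\<close> is at least
      \<open>c *\<^sub>R y n\<close>, because \<open>n < m\<close> gives \<open>c \<le> 4^m\<close>.
      So \<open>g n\<close> and \<open>g m\<close> lie below the positive and the negative part of
      the same vector.\<close>
    define c :: real where "c = 2^(n+m)"
    have c: "1 \<le> c" by (simp add: c_def)
    have "(1/c) *\<^sub>R y m \<le> (1/2)^n *\<^sub>R w"
      using scaleR_left_mono[OF yw[of m], of "(1/2)^n"] by (simp add: c_def power_add power_one_over)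
    also have "\<dots> \<le> v n" unfolding v_def using S0 by (simp add: scaleR_nonneg_nonneg)
    finally have "y n - v n \<le> y n - (1/c) *\<^sub>R y m" by (rule diff_left_mono)
    then have "g n \<le> sup (y n - (1/c) *\<^sub>R y m) 0" unfolding g_def by (intro sup_mono) auto
    also have "\<dots> = sup ((1/c) *\<^sub>R (c *\<^sub>R y n - y m)) ((1/c) *\<^sub>R 0)"
      using c by (simp add: scaleR_diff_right)
    also have "\<dots> = (1/c) *\<^sub>R sup (c *\<^sub>R y n - y m) 0" using c by (intro sup_scaleR) simp
    also have "\<dots> \<le> 1 *\<^sub>R sup (c *\<^sub>R y n - y m) 0" using c by (intro scaleR_right_mono) simp_all
    finally have 1: "g n \<le> sup (c *\<^sub>R y n - y m) 0" by simp
    have "c *\<^sub>R y n \<le> 4^m *\<^sub>R y n"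
    proof (rule scaleR_right_mono[OF _ y0])
      have "c \<le> 2^(m+m)" unfolding c_def using nm by (intro power_increasing) auto
      then show "c \<le> 4^m" by (simp add: mult_2[symmetric] power_mult)
    qed
    also have "y n \<le> S m"
    proof -
      have "(\<Sum>i\<in>{n}. y i) \<le> S m" unfolding S_def using nm y0 by (intro sum_mono2) auto
      then show ?thesis by simp
    qed
    then have "4^m *\<^sub>R y n \<le> 4^m *\<^sub>R S m" by (intro scaleR_left_mono) simp_all
    also have "\<dots> \<le> v m" unfolding v_def using w0 by (simp add: scaleR_nonneg_nonneg)
    finally have "y m - v m \<le> y m - c *\<^sub>R y n" by (rule diff_left_mono)
    then have 2: "g m \<le> sup (- (c *\<^sub>R y n - y m)) 0" unfolding g_def by (intro sup_mono) auto
    have "inf (g n) (g m) \<le> 0" using inf_mono[OF 1 2] by (simp only: parts_disjoint)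
    then show ?thesis using g0 by (intro antisym) auto
  qed
  have ff: "inf (labs (f n)) (labs (f m)) = 0" if "n < m" for n m
  proof (rule antisym)
    have "inf (labs (f n)) (labs (f m)) \<le> inf (2 *\<^sub>R g n) (2 *\<^sub>R g m)" by (intro inf_mono fg)
    also have "\<dots> = 0" using inf_scaleR[of 2 "g n" "g m"] gg[OF that] by simp
    finally show "inf (labs (f n)) (labs (f m)) \<le> 0" .
  qed simp
  have "disjoint_seq f" unfolding disjoint_seq_def
    using ff by (metis inf_commute linorder_neqE_nat)
  moreover have "(\<lambda>n. norm (z n - f n)) \<longlonglongrightarrow> 0"
  proof (rule tendsto_sandwich)
    let ?b = "\<lambda>n. norm (inf (labs (z n)) (4^n *\<^sub>R (\<Sum>i<n. labs (z i))))"
    show "\<forall>\<^sub>F n in sequentially. 0 \<le> norm (z n - f n)" by simp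
    show "(\<lambda>n. 0) \<longlonglongrightarrow> (0::real)" by simp
    have "(\<lambda>n. 2 * (?b n + (1/2)^n * norm w)) \<longlonglongrightarrow> 2 * (0 + 0 * norm w)"
      by (intro tendsto_intros lim LIMSEQ_power_zero) simp
    then show "(\<lambda>n. 2 * (?b n + (1/2)^n * norm w)) \<longlonglongrightarrow> 0" by simp
    have "norm (z n - f n) \<le> 2 * (?b n + (1/2)^n * norm w)" for n
    proof -
      \<comment> \<open>The part removed is an infimum with the barrier: its \<open>4^n\<close>
        portion is small by hypothesis, and the remainder has norm at most
        \<open>(1/2)^n * norm w\<close>.\<close>
      have cut: "x - sup (x - v n) 0 = inf x (v n)" for x
      proof -
        have "x - sup (x - v n) 0 = x + inf (v n - x) 0" by (simp add: diff_sup_eq_inf)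
        then show ?thesis by (simp add: add_inf_distrib_left inf_commute)
      qed
      have "z n - f n = (sup (z n) 0 - sup (- z n) 0) - f n"
        by (simp only: pos_part_diff_neg_part)
      also have "\<dots> = (sup (z n) 0 - sup (sup (z n) 0 - v n) 0)
          - (sup (- z n) 0 - sup (sup (- z n) 0 - v n) 0)"
      proof -
        have "(a - b) - (c - d) = (a - c) - (b - d)" for a b c d :: 'a by (simp add: algebra_simps)
        then show ?thesis unfolding f_def .
      qed
      finally have "z n - f n = (sup (z n) 0 - sup (sup (z n) 0 - v n) 0)
          - (sup (- z n) 0 - sup (sup (- z n) 0 - v n) 0)" .
      then have "z n - f n = inf (sup (z n) 0) (v n) - inf (sup (- z n) 0) (v n)"
        by (simp only: cut)
      moreover have "norm (inf (sup x 0) (v n)) \<le> ?b n + (1/2)^n * norm w" if "x \<le> y n" for x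
      proof -
        have "inf (sup x 0) (v n) \<le> inf (y n) (4^n *\<^sub>R S n) + (1/2)^n *\<^sub>R w"
        proof -
          have "inf (sup x 0) (v n) \<le> inf (y n) (v n)" using that y0 by (intro inf_mono) simp_all
          also have "\<dots> \<le> inf (y n) (4^n *\<^sub>R S n) + (1/2)^n *\<^sub>R w"
            unfolding v_def using w0 by (intro inf_add_le) (simp add: scaleR_nonneg_nonneg)
          finally show ?thesis .
        qed
        then have "norm (inf (sup x 0) (v n)) \<le> norm (inf (y n) (4^n *\<^sub>R S n) + (1/2)^n *\<^sub>R w)"
          using v0 by (intro norm_mono_nonneg) simp_all
        also have "\<dots> \<le> ?b n + norm ((1/2)^n *\<^sub>R w)"
          unfolding S_def y_def by (rule norm_triangle_ineq)
        finally show ?thesis by simp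
      qed
      ultimately show ?thesis
        using norm_triangle_ineq4[of "inf (sup (z n) 0) (v n)" "inf (sup (- z n) 0) (v n)"]
          labs_ge[of "z n"] unfolding y_def by (smt (verit))
    qed
    then show "\<forall>\<^sub>F n in sequentially. norm (z n - f n) \<le> 2 * (?b n + (1/2)^n * norm w)" by simp
  qed
  ultimately show ?thesis by (rule that)
qed

text \<open>The next term is chosen small against \<open>4^n\<close> times the sum of the moduli
  already chosen, as the perturbation lemma requires. \<open>P\<close> carries side conditions whose
  tolerance shrinks with \<open>n\<close>.\<close>

lemma exists_almost_disjoint_sequence:
  fixes P :: "real \<Rightarrow> 'a::banach_lattice \<Rightarrow> bool"
  assumes ex: "\<And>u e. 0 \<le> u \<Longrightarrow> e > 0 \<Longrightarrow> \<exists>z. P e z \<and> norm z \<le> R \<and> norm (inf (labs z) u) < e"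
  obtains z f where "\<And>n. P ((1/2)^n) (z n)" "disjoint_seq f" "(\<lambda>n. norm (z n - f n)) \<longlonglongrightarrow> 0"
proof -
  define Z where "Z e u = (SOME z. P e z \<and> norm z \<le> R \<and> norm (inf (labs z) u) < e)" for e u
  have Z: "P e (Z e u) \<and> norm (Z e u) \<le> R \<and> norm (inf (labs (Z e u)) u) < e"
    if "0 \<le> u" "e > 0" for e u
    unfolding Z_def by (rule someI_ex[OF ex[OF that]])
  \<comment> \<open>A choice depends on its predecessors only through their running sum, so the
    recursion carries just that sum.\<close>
  define S where "S = rec_nat 0 (\<lambda>n s. s + labs (Z ((1/2)^n) (4^n *\<^sub>R s)))"
  define z where "z n = Z ((1/2)^n) (4^n *\<^sub>R S n)" for n
  have S: "S 0 = 0" "S (Suc n) = S n + labs (z n)" for n by (simp_all add: S_def z_def)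
  have Ssum: "S n = (\<Sum>i<n. labs (z i))" for n by (induction n) (simp_all add: S)
  have "0 \<le> 4^n *\<^sub>R S n" for n
    unfolding Ssum by (intro scaleR_nonneg_nonneg sum_nonneg) simp_all
  then have z: "P ((1/2)^n) (z n)" "norm (z n) \<le> R"
    "norm (inf (labs (z n)) (4^n *\<^sub>R S n)) < (1/2)^n" for n
    unfolding z_def using Z[of "4^n *\<^sub>R S n" "(1/2)^n"] by simp_all
  have "(\<lambda>n. norm (inf (labs (z n)) (4^n *\<^sub>R (\<Sum>i<n. labs (z i))))) \<longlonglongrightarrow> 0"
  proof (rule tendsto_sandwich[OF _ _ tendsto_const])
    show "(\<lambda>n. (1/2)^n :: real) \<longlonglongrightarrow> 0" by (intro LIMSEQ_power_zero) simp
    show "\<forall>\<^sub>F n in sequentially. norm (inf (labs (z n)) (4^n *\<^sub>R (\<Sum>i<n. labs (z i)))) \<le> (1/2)^n"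
      using z(3) by (intro always_eventually allI) (simp add: Ssum less_imp_le)
  qed simp_all
  then obtain f where "disjoint_seq f" "(\<lambda>n. norm (z n - f n)) \<longlonglongrightarrow> 0"
    by (rule almost_disjoint_perturbation[OF z(2)])
  with z(1) show ?thesis by (rule that)
qed

section \<open>Elements of the bidual\<close>

text \<open>The gauge \<open>?p\<close> is the infimal convolution of the norm on \<open>E\<close>
  with \<open>1/\<delta>\<close> times the distance in the target. A functional supporting it at
  \<open>y\<close> satisfies the premise of \<open>le\<close>, because
  \<open>?p (T x) \<le> norm x\<close> on \<open>E\<close>, and therefore
  \<open>?p y \<le> K\<close>. The extra 1 allows for an infimum that is not attained.\<close>

lemma helly_approximation:
  fixes T :: "'a::real_normed_vector \<Rightarrow>\<^sub>L 'c::real_normed_vector"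
  assumes E: "subspace E" and d: "\<delta> > 0"
    and le: "\<And>h :: 'c \<Rightarrow>\<^sub>L real. (\<And>x. x \<in> E \<Longrightarrow> \<bar>h (T x)\<bar> \<le> norm x) \<Longrightarrow> h y \<le> K"
  obtains x where "x \<in> E" "norm x \<le> K + 1" "norm (y - T x) \<le> \<delta> * (K + 1)"
proof -
  let ?F = "\<lambda>x z. norm x + norm (z - T x) / \<delta>"
  let ?p = "\<lambda>z. INF x\<in>E. ?F x z"
  have E0: "0 \<in> E" using E by (simp add: subspace_0)
  then have ne: "E \<noteq> {}" by auto
  have F0: "0 \<le> ?F x z" for x z using d by simp
  have low: "?p z \<le> ?F x z" if "x \<in> E" for x z
    by (rule cINF_lower[OF bdd_belowI2[OF F0] that])
  have "sublinear ?p"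
  proof (rule sublinear_INF[where b="\<lambda>_. 0" and F="?F" and ?t0.0=0])
    fix s t x z assume st: "s \<in> E" "t \<in> E"
    have "norm (x + z - T (s + t)) \<le> norm (x - T s) + norm (z - T t)"
      using norm_triangle_ineq[of "x - T s" "z - T t"] by (simp add: blinfun.add_right algebra_simps)
    then have "norm (x + z - T (s + t)) / \<delta> \<le> norm (x - T s) / \<delta> + norm (z - T t) / \<delta>"
      using d by (simp add: divide_right_mono add_divide_distrib[symmetric])
    with norm_triangle_ineq[of s t] have "?F (s + t) (x + z) \<le> ?F s x + ?F t z" by simp
    then show "\<exists>r\<in>E. ?F r (x + z) \<le> ?F s x + ?F t z" using E st by (blast intro: subspace_add)
  next
    fix s x and c :: real assume s: "s \<in> E" and c: "c > 0"
    have "norm (c *\<^sub>R x - T (c *\<^sub>R s)) = c * norm (x - T s)"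
      using c by (simp add: blinfun.scaleR_right flip: scaleR_diff_right)
    then have "?F (c *\<^sub>R s) (c *\<^sub>R x) \<le> c * ?F s x" using c by (simp add: distrib_left)
    then show "\<exists>r\<in>E. ?F r (c *\<^sub>R x) \<le> c * ?F s x" using E s by (blast intro: subspace_scale)
  next
    show "0 \<le> ?F t 0" for t by (rule F0)
  qed (use E0 ne F0 in auto)
  then obtain h where h: "linear h" "\<And>z. h z \<le> ?p z" "h y = ?p y"
    using exists_linear_below_sublinear_at by blast
  have "h z \<le> (1/\<delta>) * norm z" for z using h(2)[of z] low[OF E0, of z] by simp
  then have bl: "bounded_linear h" by (rule linear_le_norm_imp_bounded(1)[OF h(1)])
  have hT: "h (T x) \<le> norm x" if "x \<in> E" for x using h(2)[of "T x"] low[OF that, of "T x"] by simp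
  have "\<bar>h (T x)\<bar> \<le> norm x" if "x \<in> E" for x
    using hT[OF that] hT[of "- x"] E that linear_neg[OF h(1), of "T x"]
    by (simp add: subspace_neg blinfun.minus_right)
  then have "?p y \<le> K" using le[of "Blinfun h"] bl h(3) by (simp add: bounded_linear_Blinfun_apply)
  have "\<exists>x\<in>E. ?F x y < K + 1"
  proof (rule ccontr)
    assume "\<not> ?thesis"
    then have "K + 1 \<le> ?p y" by (intro cINF_greatest ne) (auto simp: not_less)
    with \<open>?p y \<le> K\<close> show False by simp
  qed
  then obtain x where x: "x \<in> E" "?F x y < K + 1" by blast
  have "norm (y - T x) / \<delta> \<le> K + 1" using x(2) norm_ge_zero[of x] by linarith
  moreover have "norm x \<le> K + 1" using x(2) d divide_nonneg_pos[OF norm_ge_zero d, of "y - T x"] by linarith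
  ultimately show ?thesis using x(1) d by (intro that) (simp_all add: pos_divide_le_eq mult.commute)
qed

lemma apply_bcontfun_sum:
  "apply_bcontfun (sum F G) k = (\<Sum>g\<in>G. apply_bcontfun (F g :: 'a::topological_space \<Rightarrow>\<^sub>C real) k)"
  by (induction G rule: infinite_finite_induct) simp_all

lemma indicator_bcontfun: "(\<lambda>k. if k = j then 1 else 0 :: real) \<in> bcontfun" for j :: nat
  by (intro bcontfun_normI[where b=1]) auto

text \<open>Finitely many functionals are adjoined to the operator as extra coordinates; bounded functions
  on \<open>nat\<close> serve as a normed space with room for any finite number of coordinates.\<close>

lemma helly_approximation_finite:
  fixes T :: "'a::real_normed_vector \<Rightarrow>\<^sub>L 'b::real_normed_vector"
    and \<Phi> :: "('a \<Rightarrow>\<^sub>L real) \<Rightarrow>\<^sub>L real"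
  assumes E: "subspace E" and G: "finite G" and d: "\<delta> > 0" and K0: "0 \<le> K"
    and K: "\<And>g. (\<And>x. x \<in> E \<Longrightarrow> \<bar>blinfun_apply g x\<bar> \<le> norm x) \<Longrightarrow> \<Phi> g \<le> K"
    and y: "\<And>h :: 'b \<Rightarrow>\<^sub>L real. \<Phi> (h o\<^sub>L T) = h y"
  obtains x where "x \<in> E" "norm x \<le> K + 1" "norm (y - T x) \<le> \<delta>" "\<And>g. g \<in> G \<Longrightarrow> \<bar>blinfun_apply g x - \<Phi> g\<bar> \<le> \<delta>"
proof -
  obtain f :: "('a \<Rightarrow>\<^sub>L real) \<Rightarrow> nat" where f: "inj_on f G"
    using finite_imp_inj_to_nat_seg[OF G] by blast
  define e where "e g = Bcontfun (\<lambda>k. if k = f g then 1 else 0 :: real)" for g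
  have e: "apply_bcontfun (e g) k = (if k = f g then 1 else 0)" for g k
    unfolding e_def using Bcontfun_inverse[OF indicator_bcontfun[of "f g"]] by simp
  have coord: "\<bar>c g\<bar> \<le> norm (\<Sum>g\<in>G. c g *\<^sub>R e g)" if g: "g \<in> G" for c g
  proof -
    have "apply_bcontfun (\<Sum>g\<in>G. c g *\<^sub>R e g) (f g) = (\<Sum>g'\<in>G. if g' = g then c g' else 0)"
      unfolding apply_bcontfun_sum
      by (intro sum.cong) (use f g in \<open>auto simp: e dest: inj_onD\<close>)
    also have "\<dots> = c g" using G g by simp
    finally show ?thesis using norm_bounded[of "\<Sum>g\<in>G. c g *\<^sub>R e g" "f g"] by simp
  qed
  define S where "S = Blinfun (\<lambda>x. (T x, \<Sum>g\<in>G. blinfun_apply g x *\<^sub>R e g))"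
  have S: "S x = (T x, \<Sum>g\<in>G. blinfun_apply g x *\<^sub>R e g)" for x
    unfolding S_def
    by (subst bounded_linear_Blinfun_apply)
      (auto intro!: bounded_linear_Pair bounded_linear_sum bounded_linear_scaleR_const
        blinfun.bounded_linear_right)
  define v where "v = (y, \<Sum>g\<in>G. \<Phi> g *\<^sub>R e g)"
  have le: "h v \<le> K" if h: "\<And>x. x \<in> E \<Longrightarrow> \<bar>h (S x)\<bar> \<le> norm x"
    for h :: "('b \<times> (nat \<Rightarrow>\<^sub>C real)) \<Rightarrow>\<^sub>L real"
  proof -
    define h1 where "h1 = Blinfun (\<lambda>z. h (z, 0))"
    have h1: "h1 z = h (z, 0)" for z
      unfolding h1_def
      by (subst bounded_linear_Blinfun_apply)
        (auto intro!: bounded_linear_compose[OF blinfun.bounded_linear_right]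
          bounded_linear_Pair bounded_linear_ident bounded_linear_zero)
    have split: "h (z, \<Sum>g\<in>G. c g *\<^sub>R e g) = h1 z + (\<Sum>g\<in>G. h (0, e g) * c g)" for z c
    proof -
      have "(z, \<Sum>g\<in>G. c g *\<^sub>R e g) = (z, 0) + (\<Sum>g\<in>G. c g *\<^sub>R (0, e g))"
        by (simp add: prod_eq_iff fst_sum snd_sum)
      then show ?thesis
        by (simp add: blinfun.add_right blinfun.sum_right blinfun.scaleR_right h1 mult.commute
            del: scaleR_Pair)
    qed
    \<comment> \<open>A functional on the product pulls back to \<open>h1 o\<^sub>L T\<close> plus a
      combination of members of \<open>G\<close>; \<open>\<Phi>\<close> is known on the former by
      \<open>y\<close> and on the latter by linearity.\<close>
    have "h o\<^sub>L S = (h1 o\<^sub>L T) + (\<Sum>g\<in>G. h (0, e g) *\<^sub>R g)"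
      by (rule blinfun_eqI)
        (simp add: S split blinfun.add_left blinfun.sum_left blinfun.scaleR_left)
    then have "\<Phi> (h o\<^sub>L S) = h v"
      by (simp add: v_def split blinfun.add_right blinfun.sum_right blinfun.scaleR_right y)
    then show ?thesis using K[of "h o\<^sub>L S"] h by simp
  qed
  \<comment> \<open>Helly's error bound carries the factor \<open>K + 1\<close>, divided out in
    advance.\<close>
  have d': "\<delta> / (K + 1) > 0" using d K0 by simp
  obtain x where x: "x \<in> E" "norm x \<le> K + 1" "norm (v - S x) \<le> \<delta> / (K + 1) * (K + 1)"
    by (rule helly_approximation[OF E d' le])
  then have n: "norm (v - S x) \<le> \<delta>" using K0 by simp
  have "v - S x = (y - T x, \<Sum>g\<in>G. (\<Phi> g - g x) *\<^sub>R e g)"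
    by (simp add: v_def S scaleR_diff_left sum_subtractf)
  with n have n': "norm (y - T x, \<Sum>g\<in>G. (\<Phi> g - g x) *\<^sub>R e g) \<le> \<delta>" by (simp only:)
  note n = order_trans[OF norm_fst_le n'] order_trans[OF norm_snd_le n']
  show ?thesis
    using x(1,2) n(1)
  proof (rule that)
    fix g assume "g \<in> G"
    then show "\<bar>blinfun_apply g x - \<Phi> g\<bar> \<le> \<delta>" using coord[of g "\<lambda>g. \<Phi> g - g x"] n(2) by simp
  qed
qed

text \<open>Evaluations that are uniformly close on the dual ball come from points close in norm, as
  a norming functional of their difference shows. Approximants with tolerance tending to 0 are thus
  Cauchy.\<close>

lemma bidual_limit_of_approximants:
  fixes \<Phi> :: "('a::banach \<Rightarrow>\<^sub>L real) \<Rightarrow>\<^sub>L real"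
  assumes "\<And>\<eta>. \<eta> > 0 \<Longrightarrow> \<exists>x. \<forall>g. \<bar>\<Phi> g - blinfun_apply g x\<bar> \<le> \<eta> * norm g"
  obtains x where "\<And>g. \<Phi> g = blinfun_apply g x"
proof -
  let ?r = "\<lambda>n. inverse (real (Suc n))"
  have "\<exists>x. \<forall>g. \<bar>\<Phi> g - blinfun_apply g x\<bar> \<le> ?r n * norm g" for n by (rule assms) simp
  then obtain X where X: "\<And>n g. \<bar>\<Phi> g - blinfun_apply g (X n)\<bar> \<le> ?r n * norm g" by metis
  have dist: "norm (X m - X n) \<le> ?r m + ?r n" for m n
  proof -
    obtain h :: "'a \<Rightarrow>\<^sub>L real" where h: "\<And>z. \<bar>h z\<bar> \<le> norm z" "h (X m - X n) = norm (X m - X n)"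
      using exists_norming_functional[of "X m - X n"] by blast
    have nh: "norm h \<le> 1" using h(1) by (intro norm_blinfun_bound) simp_all
    have "\<bar>\<Phi> h - h (X k)\<bar> \<le> ?r k" for k
      using order_trans[OF X[of h k] mult_left_mono[OF nh, of "?r k"]] by simp
    from this[of m] this[of n] h(2) show ?thesis by (simp add: blinfun.diff_right)
  qed
  have "Cauchy X"
  proof (rule CauchyI)
    fix e :: real assume "e > 0"
    then obtain N where N: "?r N < e / 2" using reals_Archimedean[of "e/2"] by auto
    have r: "?r n < e / 2" if "n \<ge> N" for n
    proof -
      have "?r n \<le> ?r N" by (rule le_imp_inverse_le) (use that in simp_all)
      with N show ?thesis by linarith
    qed
    have "norm (X m - X n) < e" if "m \<ge> N" "n \<ge> N" for m n
      using dist[of m n] r[OF that(1)] r[OF that(2)] by simp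
    then show "\<exists>M. \<forall>m\<ge>M. \<forall>n\<ge>M. norm (X m - X n) < e" by blast
  qed
  then obtain x where x: "X \<longlonglongrightarrow> x" using Cauchy_convergent convergent_def by blast
  have "\<Phi> g = blinfun_apply g x" for g
  proof -
    have "(\<lambda>n. g (X n)) \<longlonglongrightarrow> \<Phi> g"
    proof (rule LIM_zero_cancel, rule Lim_null_comparison)
      show "\<forall>\<^sub>F n in sequentially. norm (g (X n) - \<Phi> g) \<le> ?r n * norm g"
        using X by (simp add: abs_minus_commute)
      show "(\<lambda>n. ?r n * norm g) \<longlonglongrightarrow> 0"
        using tendsto_mult_left_zero[OF LIMSEQ_inverse_real_of_nat] by simp
    qed
    moreover have "(\<lambda>n. g (X n)) \<longlonglongrightarrow> g x" by (intro tendsto_intros x)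
    ultimately show ?thesis by (rule LIMSEQ_unique)
  qed
  then show ?thesis by (rule that)
qed

text \<open>With \<open>E = UNIV\<close> this yields the statement on tauberian operators, and with \<open>T = 0\<close> the one on
  reflexivity.\<close>

theorem bidual_element_is_evaluation:
  fixes T :: "'a::banach_lattice \<Rightarrow>\<^sub>L 'b::real_normed_vector"
    and \<Phi> :: "('a \<Rightarrow>\<^sub>L real) \<Rightarrow>\<^sub>L real"
  assumes oc: "order_continuous TYPE('a)" and E: "subspace E" and K0: "0 \<le> K"
    and K: "\<And>g. (\<And>x. x \<in> E \<Longrightarrow> \<bar>blinfun_apply g x\<bar> \<le> norm x) \<Longrightarrow> \<Phi> g \<le> K"
    and y: "\<And>h :: 'b \<Rightarrow>\<^sub>L real. \<Phi> (h o\<^sub>L T) = h y"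
    and no_seq: "\<And>\<eta> z f. \<eta> > 0 \<Longrightarrow> (\<And>n. z n \<in> E) \<Longrightarrow> (\<And>n. \<eta> \<le> norm (z n)) \<Longrightarrow> disjoint_seq f
      \<Longrightarrow> (\<lambda>n. norm (z n - f n)) \<longlonglongrightarrow> 0 \<Longrightarrow> (\<lambda>n. T (z n)) \<longlonglongrightarrow> 0 \<Longrightarrow> False"
  obtains x where "\<And>g. \<Phi> g = blinfun_apply g x"
proof (rule bidual_limit_of_approximants[of \<Phi>])
  define C where "C G \<delta> = {x\<in>E. norm x \<le> K + 1 \<and> norm (y - T x) \<le> \<delta> \<and> (\<forall>g\<in>G. \<bar>blinfun_apply g x - \<Phi> g\<bar> \<le> \<delta>)}"
    for G \<delta>
  define \<C> where "\<C> = {C G \<delta> | G \<delta>. finite G \<and> \<delta> > 0}"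
  fix \<eta> :: real assume eta: "\<eta> > 0"
  \<comment> \<open>A single \<open>e\<close> limits both the distance of \<open>T x\<close> from
    \<open>y\<close> and the truncated difference. The negation then yields, for each tolerance,
    exactly the differences needed for an almost disjoint sequence, with images of norm at most
    \<open>2 * e\<close>.\<close>
  have "\<exists>u e. 0 \<le> u \<and> e > 0 \<and> (\<forall>x\<in>C {} e. \<forall>x'\<in>C {} e.
      norm (inf (labs (x - x')) u) < e \<longrightarrow> norm (x - x') < \<eta>)"
  proof (rule ccontr)
    assume neg: "\<not> ?thesis"
    let ?P = "\<lambda>e z. z \<in> E \<and> \<eta> \<le> norm z \<and> norm (T z) \<le> 2 * e"
    have ex: "\<exists>z. ?P e z \<and> norm z \<le> 2 * (K + 1) \<and> norm (inf (labs z) u) < e"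
      if ue: "0 \<le> u" "e > 0" for u e
    proof -
      obtain x x' where x: "x \<in> C {} e" "x' \<in> C {} e" "norm (inf (labs (x - x')) u) < e"
        "\<eta> \<le> norm (x - x')"
        using neg ue by (meson not_less)
      have "T (x - x') = (y - T x') - (y - T x)" by (simp add: blinfun.diff_right)
      then have "norm (T (x - x')) \<le> norm (y - T x') + norm (y - T x)"
        by (metis norm_triangle_ineq4)
      also have "\<dots> \<le> 2 * e" using x(1,2) by (simp add: C_def)
      finally have "norm (T (x - x')) \<le> 2 * e" .
      moreover have "norm (x - x') \<le> 2 * (K + 1)"
        using norm_triangle_ineq4[of x x'] x(1,2) by (simp add: C_def)
      moreover have "x - x' \<in> E" using x(1,2) E by (simp add: C_def subspace_diff)
      ultimately show ?thesis using x(3,4) by blast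
    qed
    obtain z f where z: "\<And>n. ?P ((1/2)^n) (z n)" and f: "disjoint_seq f"
      "(\<lambda>n. norm (z n - f n)) \<longlonglongrightarrow> 0"
      by (rule exists_almost_disjoint_sequence[of ?P "2 * (K + 1)"])
        (rule ex, assumption, assumption, rule that)
    have "(\<lambda>n. T (z n)) \<longlonglongrightarrow> 0"
    proof (rule Lim_null_comparison)
      show "\<forall>\<^sub>F n in sequentially. norm (T (z n)) \<le> 2 * (1/2)^n" using z by simp
      have "(\<lambda>n. 2 * (1/2)^n :: real) \<longlonglongrightarrow> 2 * 0" by (intro tendsto_intros LIMSEQ_power_zero) simp
      then show "(\<lambda>n. 2 * (1/2)^n :: real) \<longlonglongrightarrow> 0" by simp
    qed
    with z f show False by (intro no_seq[OF eta, of z f]) auto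
  qed
  then obtain u e where u: "0 \<le> u" and e: "e > 0"
    and H: "\<And>x x'. x \<in> C {} e \<Longrightarrow> x' \<in> C {} e \<Longrightarrow> norm (inf (labs (x - x')) u) < e \<Longrightarrow> norm (x - x') < \<eta>"
    by blast
  have KC: "C {} e \<in> \<C>" unfolding \<C>_def using e by blast
  have neC: "D \<noteq> {}" if D: "D \<in> \<C>" for D
  proof -
    obtain G \<delta> where G: "D = C G \<delta>" "finite G" "\<delta> > 0" using D unfolding \<C>_def by blast
    obtain x where "x \<in> E" "norm x \<le> K + 1" "norm (y - T x) \<le> \<delta>" "\<And>g. g \<in> G \<Longrightarrow> \<bar>blinfun_apply g x - \<Phi> g\<bar> \<le> \<delta>"
      by (rule helly_approximation_finite[OF E G(2,3) K0 K y]) (assumption, rule that)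
    then show ?thesis unfolding G(1) C_def by blast
  qed
  have cvC: "convex D" if D: "D \<in> \<C>" for D
  proof -
    obtain G \<delta> where G: "D = C G \<delta>" using D unfolding \<C>_def by blast
    have "C G \<delta> = E \<inter> cball 0 (K + 1) \<inter> blinfun_apply T -` cball y \<delta> \<inter> (\<Inter>g\<in>G. blinfun_apply g -` cball (\<Phi> g) \<delta>)"
      by (auto simp: C_def dist_norm abs_minus_commute)
    moreover have "convex \<dots>"
      by (intro convex_Int convex_INT convex_linear_vimage convex_cball subspace_imp_convex E
          bounded_linear.linear blinfun.bounded_linear_right)
    ultimately show ?thesis unfolding G by simp
  qed
  have bdC: "norm x \<le> K + 1" if "D \<in> \<C>" "x \<in> D" for D x
    using that unfolding \<C>_def C_def by blast
  have dirC: "\<exists>F\<in>\<C>. F \<subseteq> D \<inter> D'" if DD: "D \<in> \<C>" "D' \<in> \<C>" for D D'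
  proof -
    obtain G \<delta> where G: "D = C G \<delta>" "finite G" "\<delta> > 0" using DD(1) unfolding \<C>_def by blast
    obtain G' \<delta>' where G': "D' = C G' \<delta>'" "finite G'" "\<delta>' > 0" using DD(2) unfolding \<C>_def by blast
    have "finite (G \<union> G')" "min \<delta> \<delta>' > 0" using G G' by simp_all
    then have "C (G \<union> G') (min \<delta> \<delta>') \<in> \<C>" unfolding \<C>_def by blast
    moreover have "C (G \<union> G') (min \<delta> \<delta>') \<subseteq> D \<inter> D'" unfolding G(1) G'(1) C_def by auto
    ultimately show ?thesis by blast
  qed
  obtain x0 where x0: "\<And>D. D \<in> \<C> \<Longrightarrow> \<exists>x\<in>D. norm (x - x0) < \<eta>"
    by (rule directed_convex_concentration[OF oc neC cvC bdC dirC u e KC H]) (assumption | rule that)+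
  \<comment> \<open>\<open>x0\<close> need not lie in the set for \<open>g\<close> and
    \<open>\<delta>\<close>, but a point of that set is within \<open>\<eta>\<close> of it; then
    \<open>\<delta>\<close> tends to 0 with \<open>x0\<close> fixed.\<close>
  have "\<bar>\<Phi> g - blinfun_apply g x0\<bar> \<le> \<eta> * norm g" for g
  proof (rule field_le_epsilon)
    fix \<delta> :: real assume "\<delta> > 0"
    then have "C {g} \<delta> \<in> \<C>" unfolding \<C>_def by blast
    from x0[OF this] obtain x where x: "\<bar>blinfun_apply g x - \<Phi> g\<bar> \<le> \<delta>" "norm (x - x0) < \<eta>"
      unfolding C_def by blast
    have "\<bar>g (x - x0)\<bar> \<le> norm g * norm (x - x0)" using norm_blinfun[of g "x - x0"] by simp
    also have "\<dots> \<le> \<eta> * norm g" using mult_left_mono[OF less_imp_le[OF x(2)] norm_ge_zero[of g]]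
      by (simp only: mult.commute)
    finally have "\<bar>g x - g x0\<bar> \<le> \<eta> * norm g" by (simp add: blinfun.diff_right)
    with x(1) show "\<bar>\<Phi> g - blinfun_apply g x0\<bar> \<le> \<eta> * norm g + \<delta>" by linarith
  qed
  then show "\<exists>x. \<forall>g. \<bar>\<Phi> g - blinfun_apply g x\<bar> \<le> \<eta> * norm g" by blast
qed (rule that)

section \<open>DNS operators\<close>

lemma inf_labs_add_eq_0:
  fixes a s t :: "'a::banach_lattice"
  assumes "inf (labs a) (labs s) = 0" "inf (labs a) (labs t) = 0"
  shows "inf (labs a) (labs (s + t)) = 0"
proof (rule antisym)
  have "inf (labs a) (labs (s + t)) \<le> inf (labs s + labs t) (labs a)"
    using labs_triangle[of s t] by (simp add: le_infI2)
  also have "\<dots> \<le> inf (labs s) (labs a) + inf (labs t) (labs a)"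
    by (intro inf_add_le_add_inf) simp_all
  also have "\<dots> = 0" using assms by (simp add: inf_commute)
  finally show "inf (labs a) (labs (s + t)) \<le> 0" .
qed simp

lemma inf_labs_scaleR_eq_0:
  fixes a s :: "'a::banach_lattice"
  assumes "inf (labs a) (labs s) = 0"
  shows "inf (labs a) (labs (c *\<^sub>R s)) = 0"
proof (rule antisym)
  have "\<bar>c\<bar> *\<^sub>R labs s \<le> (\<bar>c\<bar> + 1) *\<^sub>R labs s" by (intro scaleR_right_mono) simp_all
  then have "inf (labs a) (labs (c *\<^sub>R s)) \<le> inf ((\<bar>c\<bar> + 1) *\<^sub>R labs s) (labs a)"
    unfolding labs_scaleR by (simp add: le_infI2)
  also have "\<dots> \<le> (\<bar>c\<bar> + 1) *\<^sub>R inf (labs s) (labs a)"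
    by (intro inf_scaleR_left_le) simp_all
  also have "\<dots> = 0" using assms by (simp add: inf_commute)
  finally show "inf (labs a) (labs (c *\<^sub>R s)) \<le> 0" .
qed simp

lemma norm_le_norm_diff_disjoint:
  fixes x s :: "'a::banach_lattice"
  assumes "inf (labs x) (labs s) = 0"
  shows "norm x \<le> norm (x - s)"
proof (rule norm_le_of_labs_le)
  have "labs x \<le> inf (labs (x - s) + labs s) (labs x)"
    using labs_triangle[of "x - s" s] by simp
  also have "\<dots> \<le> inf (labs (x - s)) (labs x) + inf (labs s) (labs x)"
    by (intro inf_add_le_add_inf) simp_all
  also have "\<dots> \<le> labs (x - s)" using assms by (simp add: inf_commute)
  finally show "labs x \<le> labs (x - s)" .
qed

text \<open>The disjoint complement of \<open>f n\<close> is a subspace containing all other terms,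
  and subtracting a disjoint vector cannot decrease the norm. So \<open>f n\<close> has distance
  \<open>norm (f n)\<close> from the span of the others, and the distance functional serves as
  coordinate.\<close>

lemma disjoint_seq_coordinate_functional:
  fixes f :: "nat \<Rightarrow> 'a::banach_lattice"
  assumes f: "disjoint_seq f"
  obtains h :: "'a \<Rightarrow>\<^sub>L real" where "\<And>x. \<bar>h x\<bar> \<le> norm x" "\<And>m. m \<noteq> n \<Longrightarrow> h (f m) = 0"
    "h (f n) = norm (f n)"
proof -
  let ?S = "span (f ` (- {n}))"
  obtain h :: "'a \<Rightarrow>\<^sub>L real" where h: "\<And>x. \<bar>h x\<bar> \<le> norm x" "\<And>x. x \<in> ?S \<Longrightarrow> h x = 0"
    "h (f n) = infdist (f n) ?S"
    using exists_functional_infdist[of ?S "f n"] by auto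
  have "?S \<subseteq> {s. inf (labs (f n)) (labs s) = 0}"
  proof (rule span_minimal)
    show "f ` (- {n}) \<subseteq> {s. inf (labs (f n)) (labs s) = 0}"
      using f by (auto simp: disjoint_seq_def)
    show "subspace {s. inf (labs (f n)) (labs s) = 0}"
      by (rule subspaceI)
        (auto simp: inf_labs_add_eq_0 inf_labs_scaleR_eq_0 inf_absorb2)
  qed
  then have "norm (f n) \<le> dist (f n) s" if "s \<in> ?S" for s
    using norm_le_norm_diff_disjoint[of "f n" s] that by (auto simp: dist_norm)
  moreover have "?S \<noteq> {}" using span_zero by blast
  ultimately have "norm (f n) \<le> infdist (f n) ?S"
    unfolding infdist_def by (simp add: cINF_greatest)
  with h(1)[of "f n"] h(3) have "h (f n) = norm (f n)" by simp
  moreover have "h (f m) = 0" if "m \<noteq> n" for m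
    using that by (intro h(2) span_base) auto
  ultimately show ?thesis using h(1) by (intro that)
qed

text \<open>Each functional cuts the dimension by at most one. It is applied in contrapositive form:
  an infinite-dimensional subspace contains a nonzero vector killed by any given finite number of
  functionals.\<close>

lemma finite_span_of_injective_functionals:
  fixes h :: "nat \<Rightarrow> 'a::real_normed_vector \<Rightarrow>\<^sub>L real"
  assumes "subspace N" "\<And>x. x \<in> N \<Longrightarrow> (\<And>i. i < k \<Longrightarrow> h i x = 0) \<Longrightarrow> x = 0"
  shows "\<exists>B. finite B \<and> span B = N"
  using assms
proof (induction k arbitrary: N)
  case 0
  then have "N = {0}" using subspace_0 by auto
  then show ?case by (intro exI[of _ "{}"]) simp
next
  case (Suc k)
  define N' where "N' = {x\<in>N. h k x = 0}"
  have "subspace N'"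
    using Suc.prems(1) unfolding N'_def
    by (auto simp: subspace_def blinfun.add_right blinfun.scaleR_right)
  moreover have "x = 0" if "x \<in> N'" "\<And>i. i < k \<Longrightarrow> h i x = 0" for x
  proof (rule Suc.prems(2))
    show "x \<in> N" using that(1) by (simp add: N'_def)
    show "h i x = 0" if "i < Suc k" for i
      using that \<open>x \<in> N'\<close> \<open>\<And>i. i < k \<Longrightarrow> h i x = 0\<close> by (auto simp: N'_def less_Suc_eq)
  qed
  ultimately obtain B where B: "finite B" "span B = N'" using Suc.IH[of N'] by blast
  show ?case
  proof (cases "N' = N")
    case False
    then obtain v where v: "v \<in> N" "h k v \<noteq> 0" by (auto simp: N'_def)
    have "span (insert v B) = N"
    proof
      have "B \<subseteq> N" using span_superset[of B] B(2) by (auto simp: N'_def)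
      then show "span (insert v B) \<subseteq> N" using v(1) Suc.prems(1) by (intro span_minimal) auto
      show "N \<subseteq> span (insert v B)"
      proof
        fix x assume x: "x \<in> N"
        have "x - (h k x / h k v) *\<^sub>R v \<in> N'"
          using x v Suc.prems(1)
          by (simp add: N'_def subspace_diff subspace_scale blinfun.diff_right blinfun.scaleR_right)
        then show "x \<in> span (insert v B)" unfolding span_insert B(2) by blast
      qed
    qed
    with B(1) show ?thesis by (intro exI[of _ "insert v B"]) simp
  qed (use B in blast)
qed

section \<open>Decay of an operator along a disjoint sequence\<close>

lemma geometric_tail_le: "k \<le> m \<Longrightarrow> (\<Sum>i=k..<m. (1/2)^i :: real) \<le> 2 * (1/2)^k"
proof -
  assume "k \<le> m"
  then have "(\<Sum>i=k..<m. (1/2)^i :: real) = 2 * (1/2)^k - 2 * (1/2)^m"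
    by (induction m rule: dec_induct) simp_all
  then show ?thesis by simp
qed

text \<open>On the closed span, \<open>T\<close> is a uniform limit of finite-rank maps built from
  the coordinates \<open>a i\<close>, with error at most \<open>2 * (1/2)^k\<close> times the norm.
  A nonzero vector of \<open>N\<close> whose first \<open>k\<close> coordinates vanish therefore
  violates the lower bound \<open>c\<close>.\<close>

lemma strictly_singular_on_disjoint_seq:
  fixes T :: "'a::banach_lattice \<Rightarrow>\<^sub>L 'b::real_normed_vector"
  assumes f: "disjoint_seq f" and nz: "\<And>n. f n \<noteq> 0"
    and small: "\<And>n. norm (T (f n)) \<le> (1/2)^n * norm (f n)"
  shows "\<not> not_strictly_singular_on T (closure (span (range f)))"
proof
  assume "not_strictly_singular_on T (closure (span (range f)))"
  then obtain N c where N: "subspace N" "N \<subseteq> closure (span (range f))" "\<not> (\<exists>B. finite B \<and> span B = N)"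
    and c: "c > 0" "\<And>x. x \<in> N \<Longrightarrow> c * norm x \<le> norm (T x)"
    unfolding not_strictly_singular_on_def by blast
  have "\<exists>h :: 'a \<Rightarrow>\<^sub>L real. (\<forall>x. \<bar>h x\<bar> \<le> norm x) \<and> (\<forall>m. m \<noteq> n \<longrightarrow> h (f m) = 0) \<and> h (f n) = norm (f n)" for n
    by (rule disjoint_seq_coordinate_functional[OF f, of n]) blast
  then obtain h :: "nat \<Rightarrow> 'a \<Rightarrow>\<^sub>L real" where h: "\<And>n x. \<bar>h n x\<bar> \<le> norm x"
    "\<And>n m. m \<noteq> n \<Longrightarrow> h n (f m) = 0" "\<And>n. h n (f n) = norm (f n)" by metis
  define a where "a i x = h i x / norm (f i)" for i x
  have a_add: "a i (x + y) = a i x + a i y" and a_scale: "a i (r *\<^sub>R x) = r * a i x" for i x y r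
    by (simp_all add: a_def blinfun.add_right blinfun.scaleR_right add_divide_distrib)
  have a_f: "a i (f j) = (if i = j then 1 else 0)" for i j
    using h(2)[of j i] h(3)[of i] nz[of i] by (cases "i = j") (simp_all add: a_def)
  \<comment> \<open>Demanding the expansion for all large \<open>m\<close> lets expansions of
    different lengths be added.\<close>
  let ?V = "{x. \<exists>m0. \<forall>m\<ge>m0. x = (\<Sum>i<m. a i x *\<^sub>R f i)}"
  have expand: "span (range f) \<subseteq> ?V"
  proof (rule span_minimal)
    have "f j = (\<Sum>i<m. a i (f j) *\<^sub>R f i)" if "m \<ge> Suc j" for j m
    proof -
      have "(\<Sum>i<m. a i (f j) *\<^sub>R f i) = (\<Sum>i<m. if i = j then f j else 0)"
        by (intro sum.cong) (auto simp: a_f)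
      then show ?thesis using that by simp
    qed
    then show "range f \<subseteq> ?V" by blast
    show "subspace ?V"
    proof (rule subspaceI)
      show "0 \<in> ?V" by (simp add: a_def)
    next
      fix x y assume "x \<in> ?V" "y \<in> ?V"
      then obtain m1 m2 where m: "\<And>m. m \<ge> m1 \<Longrightarrow> x = (\<Sum>i<m. a i x *\<^sub>R f i)"
        "\<And>m. m \<ge> m2 \<Longrightarrow> y = (\<Sum>i<m. a i y *\<^sub>R f i)" by blast
      have "x + y = (\<Sum>i<m. a i (x + y) *\<^sub>R f i)" if "m \<ge> max m1 m2" for m
      proof -
        have "(\<Sum>i<m. a i (x + y) *\<^sub>R f i) = (\<Sum>i<m. a i x *\<^sub>R f i) + (\<Sum>i<m. a i y *\<^sub>R f i)"
          by (simp add: a_add scaleR_add_left sum.distrib)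
        also have "\<dots> = x + y" using m(1)[of m] m(2)[of m] that by simp
        finally show ?thesis ..
      qed
      then show "x + y \<in> ?V" by blast
    next
      fix r x assume "x \<in> ?V"
      then obtain m1 where m: "\<And>m. m \<ge> m1 \<Longrightarrow> x = (\<Sum>i<m. a i x *\<^sub>R f i)" by blast
      have "r *\<^sub>R x = (\<Sum>i<m. a i (r *\<^sub>R x) *\<^sub>R f i)" if "m \<ge> m1" for m
      proof -
        have "(\<Sum>i<m. a i (r *\<^sub>R x) *\<^sub>R f i) = r *\<^sub>R (\<Sum>i<m. a i x *\<^sub>R f i)"
          by (simp add: a_scale scaleR_sum_right)
        also have "\<dots> = r *\<^sub>R x" using m[OF that] by simp
        finally show ?thesis ..
      qed
      then show "r *\<^sub>R x \<in> ?V" by blast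
    qed
  qed
  have tail: "norm (T x - (\<Sum>i<k. a i x *\<^sub>R T (f i))) \<le> 2 * (1/2)^k * norm x"
    if x: "x \<in> span (range f)" for k x
  proof -
    obtain m0 where "\<forall>m\<ge>m0. x = (\<Sum>i<m. a i x *\<^sub>R f i)" using expand x by blast
    then have m: "x = (\<Sum>i<max m0 k. a i x *\<^sub>R f i)" by simp
    define m where "m = max m0 k"
    have km: "k \<le> m" by (simp add: m_def)
    have "T x = T (\<Sum>i<m. a i x *\<^sub>R f i)" using m by (simp add: m_def)
    then have "T x = (\<Sum>i<m. a i x *\<^sub>R T (f i))"
      by (simp add: blinfun.sum_right blinfun.scaleR_right)
    also have "\<dots> = (\<Sum>i<k. a i x *\<^sub>R T (f i)) + (\<Sum>i=k..<m. a i x *\<^sub>R T (f i))"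
      using sum.atLeastLessThan_concat[of 0 k m "\<lambda>i. a i x *\<^sub>R T (f i)"] km
      by (simp add: atLeast0LessThan)
    finally have "T x - (\<Sum>i<k. a i x *\<^sub>R T (f i)) = (\<Sum>i=k..<m. a i x *\<^sub>R T (f i))" by simp
    moreover have "norm (\<Sum>i=k..<m. a i x *\<^sub>R T (f i)) \<le> (\<Sum>i=k..<m. (1/2)^i * norm x)"
    proof (rule sum_norm_le)
      fix i
      have "norm (a i x *\<^sub>R T (f i)) = \<bar>h i x\<bar> * (norm (T (f i)) / norm (f i))"
        by (simp add: a_def)
      also have "\<dots> \<le> norm x * (1/2)^i"
        using h(1)[of i x] small[of i] nz[of i] by (intro mult_mono) (simp_all add: pos_divide_le_eq)
      finally show "norm (a i x *\<^sub>R T (f i)) \<le> (1/2)^i * norm x" by (simp add: mult.commute)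
    qed
    moreover have "(\<Sum>i=k..<m. (1/2)^i * norm x) \<le> 2 * (1/2)^k * norm x"
      using mult_right_mono[OF geometric_tail_le[OF km], of "norm x"]
      by (simp add: sum_distrib_right)
    ultimately show ?thesis by simp
  qed
  \<comment> \<open>For fixed \<open>k\<close> the estimate is a closed condition on
    \<open>x\<close>, so it passes from the span to its closure without expanding points of the
    closure in a series.\<close>
  have closed: "closed {x. norm (T x - (\<Sum>i<k. a i x *\<^sub>R T (f i))) \<le> 2 * (1/2)^k * norm x}" for k
    unfolding a_def divide_inverse by (intro closed_Collect_le continuous_intros)
  have tail': "norm (T x - (\<Sum>i<k. a i x *\<^sub>R T (f i))) \<le> 2 * (1/2)^k * norm x" if "x \<in> N" for k x
    using closure_minimal[OF _ closed[of k], of "span (range f)"] tail[of _ k] N(2) that by blast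
  obtain k where k: "(1/2)^k < c / 2" using real_arch_pow_inv[of "c/2" "1/2"] c(1) by auto
  have "\<exists>x\<in>N. (\<forall>i<k. h i x = 0) \<and> x \<noteq> 0"
    using finite_span_of_injective_functionals[OF N(1), of k h] N(3) by blast
  then obtain x where x: "x \<in> N" "\<And>i. i < k \<Longrightarrow> h i x = 0" "x \<noteq> 0" by blast
  have "c * norm x \<le> 2 * (1/2)^k * norm x"
    using c(2)[OF x(1)] tail'[OF x(1), of k] x(2) by (simp add: a_def)
  then have "c \<le> 2 * (1/2)^k" using x(3) by simp
  with k show False by simp
qed

text \<open>Sequential form of the DNS property: a subsequence whose images decay geometrically
  relative to \<open>\<eta>\<close> makes \<open>T\<close> strictly singular on its closed
  span.\<close>

lemma DNS_not_null_on_disjoint: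
  fixes T :: "'a::banach_lattice \<Rightarrow>\<^sub>L 'b::real_normed_vector"
  assumes T: "DNS T" and f: "disjoint_seq f" and eta: "\<eta> > 0" "\<And>n. \<eta> \<le> norm (f n)"
    and lim: "(\<lambda>n. T (f n)) \<longlonglongrightarrow> 0"
  shows False
proof -
  have ev: "\<exists>n>m. norm (T (f n)) \<le> (1/2)^k * \<eta>" for k m
  proof -
    have "(1/2)^k * \<eta> > 0" using eta by simp
    from LIMSEQ_D[OF lim this] obtain n0 where "\<And>n. n \<ge> n0 \<Longrightarrow> norm (T (f n)) < (1/2)^k * \<eta>" by auto
    from this[of "max n0 (Suc m)"] show ?thesis by (intro exI[of _ "max n0 (Suc m)"]) simp
  qed
  have "\<exists>r. \<forall>k. norm (T (f (r k))) \<le> (1/2)^k * \<eta> \<and> r k < r (Suc k)"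
    by (rule dependent_nat_choice[where P="\<lambda>k n. norm (T (f n)) \<le> (1/2)^k * \<eta>" and Q="\<lambda>_ m n. m < n"])
      (use ev in blast)+
  then obtain r where r: "\<And>k. norm (T (f (r k))) \<le> (1/2)^k * \<eta>" "\<And>k. r k < r (Suc k)" by blast
  have inj: "inj r" using r(2) by (intro strict_mono_imp_inj_on) (simp add: strict_mono_Suc_iff)
  define g where "g k = f (r k)" for k
  have g: "disjoint_seq g" using f inj by (simp add: disjoint_seq_def g_def inj_eq)
  have nz: "g k \<noteq> 0" for k using eta(1) eta(2)[of "r k"] by (auto simp: g_def)
  have "norm (T (g k)) \<le> (1/2)^k * norm (g k)" for k
    unfolding g_def using r(1)[of k] by (rule order_trans) (intro mult_left_mono eta; simp)
  then have "\<not> not_strictly_singular_on T (closure (span (range g)))"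
    by (rule strictly_singular_on_disjoint_seq[OF g nz])
  then show False using T g nz unfolding DNS_def by blast
qed

theorem DNS_imp_tauberian:
  fixes T :: "'a::banach_lattice \<Rightarrow>\<^sub>L 'b::real_normed_vector"
  assumes oc: "order_continuous TYPE('a)" and T: "DNS T"
  shows "tauberian T"
  unfolding tauberian_def
proof (intro allI impI)
  fix \<Phi> :: "('a \<Rightarrow>\<^sub>L real) \<Rightarrow>\<^sub>L real"
  assume "\<exists>y. \<forall>g :: 'b \<Rightarrow>\<^sub>L real. \<Phi> (g o\<^sub>L T) = g y"
  then obtain y where y: "\<And>g :: 'b \<Rightarrow>\<^sub>L real. \<Phi> (g o\<^sub>L T) = g y" by blast
  have K: "\<Phi> g \<le> norm \<Phi>" if g: "\<And>x. x \<in> UNIV \<Longrightarrow> \<bar>blinfun_apply g x\<bar> \<le> norm x" for g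
  proof -
    have "norm g \<le> 1" using g by (intro norm_blinfun_bound) simp_all
    then show ?thesis
      using norm_blinfun[of \<Phi> g] mult_left_mono[of "norm g" 1 "norm \<Phi>"] by simp
  qed
  have no_seq: False
    if eta: "\<eta> > 0" and z: "\<And>n. \<eta> \<le> norm (z n)" and f: "disjoint_seq f"
      and zf: "(\<lambda>n. norm (z n - f n)) \<longlonglongrightarrow> 0" and Tz: "(\<lambda>n. T (z n)) \<longlonglongrightarrow> 0"
    for \<eta> and z f :: "nat \<Rightarrow> 'a"
  proof -
    \<comment> \<open>Early terms of \<open>f\<close> may be small or zero; beyond \<open>n0\<close>
      they have norm at least \<open>\<eta> / 2\<close>.\<close>
    have "\<eta> / 2 > 0" using eta by simp
    from LIMSEQ_D[OF zf this] obtain n0 where n0: "\<And>n. n \<ge> n0 \<Longrightarrow> norm (z n - f n) < \<eta> / 2" by auto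
    have "\<eta> / 2 \<le> norm (f (n + n0))" for n
      using norm_triangle_ineq2[of "z (n + n0)" "f (n + n0)"]
        norm_triangle_ineq[of "z (n + n0) - f (n + n0)" "f (n + n0)"]
        z[of "n + n0"] n0[of "n + n0"] by simp
    moreover have "disjoint_seq (\<lambda>n. f (n + n0))" using f by (simp add: disjoint_seq_def)
    moreover have "(\<lambda>n. T (f (n + n0))) \<longlonglongrightarrow> 0"
    proof -
      have "(\<lambda>n. T (z n) - T (z n - f n)) \<longlonglongrightarrow> 0 - T 0"
        by (intro tendsto_intros Tz tendsto_norm_zero_cancel[OF zf])
      then have "(\<lambda>n. T (f n)) \<longlonglongrightarrow> 0" by (simp add: blinfun.diff_right blinfun.zero_right)
      then show ?thesis by (rule LIMSEQ_ignore_initial_segment)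
    qed
    ultimately show False using DNS_not_null_on_disjoint[OF T] \<open>\<eta> / 2 > 0\<close> by blast
  qed
  obtain x where "\<And>g. \<Phi> g = blinfun_apply g x"
    by (rule bidual_element_is_evaluation[OF oc subspace_UNIV norm_ge_zero[of \<Phi>] K y no_seq])
      auto
  then show "\<exists>x. \<forall>f. \<Phi> f = blinfun_apply f x" by blast
qed

section \<open>Dispersed subspaces\<close>

lemma disjoint_seq_scaleR:
  assumes "disjoint_seq f"
  shows "disjoint_seq (\<lambda>n. c n *\<^sub>R f n)"
  unfolding disjoint_seq_def
proof (intro allI impI)
  fix n m :: nat assume "n \<noteq> m"
  then have "inf (labs (f n)) (labs (c m *\<^sub>R f m)) = 0"
    using assms by (intro inf_labs_scaleR_eq_0) (simp add: disjoint_seq_def)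
  then have "inf (labs (c m *\<^sub>R f m)) (labs (f n)) = 0" by (simp only: inf_commute)
  then have "inf (labs (c m *\<^sub>R f m)) (labs (c n *\<^sub>R f n)) = 0" by (rule inf_labs_scaleR_eq_0)
  then show "inf (labs (c n *\<^sub>R f n)) (labs (c m *\<^sub>R f m)) = 0" by (simp only: inf_commute)
qed

text \<open>Normalizing \<open>z n\<close> enlarges the error by at most the factor
  \<open>inverse \<eta>\<close>, and rescaling individual terms keeps \<open>f\<close>
  disjoint.\<close>

lemma dispersed_no_almost_disjoint:
  fixes E :: "'a::banach_lattice set"
  assumes E: "subspace E" "dispersed E" and eta: "\<eta> > 0"
    and z: "\<And>n. z n \<in> E" "\<And>n. \<eta> \<le> norm (z n)"
    and f: "disjoint_seq f" and zf: "(\<lambda>n. norm (z n - f n)) \<longlonglongrightarrow> 0"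
  shows False
proof -
  define c where "c n = inverse (norm (z n))" for n
  have z0: "z n \<noteq> 0" for n using z(2)[of n] eta by auto
  have "c n *\<^sub>R z n \<in> E \<and> norm (c n *\<^sub>R z n) = 1" for n
    using z(1) z0 E(1) by (simp add: c_def subspace_scale)
  moreover have "(\<lambda>n. norm (c n *\<^sub>R z n - c n *\<^sub>R f n)) \<longlonglongrightarrow> 0"
  proof (rule Lim_null_comparison)
    have "norm (norm (c n *\<^sub>R z n - c n *\<^sub>R f n)) \<le> inverse \<eta> * norm (z n - f n)" for n
    proof -
      have "norm (c n *\<^sub>R z n - c n *\<^sub>R f n) = c n * norm (z n - f n)"
        by (simp add: c_def flip: scaleR_diff_right)
      also have "\<dots> \<le> inverse \<eta> * norm (z n - f n)"
        unfolding c_def using z(2)[of n] eta by (intro mult_right_mono le_imp_inverse_le) simp_all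
      finally show ?thesis by simp
    qed
    then show "\<forall>\<^sub>F n in sequentially.
        norm (norm (c n *\<^sub>R z n - c n *\<^sub>R f n)) \<le> inverse \<eta> * norm (z n - f n)" by simp
    show "(\<lambda>n. inverse \<eta> * norm (z n - f n)) \<longlonglongrightarrow> 0" using tendsto_mult_right_zero[OF zf] .
  qed
  ultimately have "almost_disjoint E (\<lambda>n. c n *\<^sub>R z n)"
    unfolding almost_disjoint_def using disjoint_seq_scaleR[OF f, of c] by blast
  then show False using E(2) unfolding dispersed_def by blast
qed

text \<open>Composition with restriction to \<open>E\<close> turns \<open>\<Phi>\<close> into an
  element \<open>\<Psi>\<close> of the bidual of the whole space, which is evaluation at some
  \<open>x\<close>. That \<open>x\<close> lies in \<open>E\<close> follows because
  \<open>\<Psi>\<close> kills functionals vanishing on \<open>E\<close>; the result returns to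
  \<open>E\<close> by extending its functionals.\<close>

theorem dispersed_imp_reflexive:
  fixes E :: "'a::banach_lattice set"
  assumes oc: "order_continuous TYPE('a)" and cl: "closed E" and E: "subspace E" and disp: "dispersed E"
  shows "reflexive_subspace E"
  unfolding reflexive_subspace_def
proof
  fix \<Phi> assume "\<Phi> \<in> sub_bidual E"
  then obtain K0 where Phi:
    "\<And>g h. g \<in> sub_dual E \<Longrightarrow> h \<in> sub_dual E \<Longrightarrow> \<Phi> (\<lambda>x. g x + h x) = \<Phi> g + \<Phi> h"
    "\<And>g c. g \<in> sub_dual E \<Longrightarrow> \<Phi> (\<lambda>x. c * g x) = c * \<Phi> g"
    "\<And>g. g \<in> sub_dual E \<Longrightarrow> \<bar>\<Phi> g\<bar> \<le> K0 * sub_dual_norm E g"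
    unfolding sub_bidual_def by blast
  have E0: "0 \<in> E" using E by (rule subspace_0)
  \<comment> \<open>Members of \<open>sub_dual E\<close> vanish off \<open>E\<close> by definition,
    so restriction means cutting off to 0 there.\<close>
  define res where "res g = (\<lambda>x. if x \<in> E then blinfun_apply g x else 0)" for g :: "'a \<Rightarrow>\<^sub>L real"
  have res_dual: "res g \<in> sub_dual E" for g
  proof -
    have "\<exists>K. \<forall>x\<in>E. \<bar>res g x\<bar> \<le> K * norm x"
      using norm_blinfun[of g] by (intro exI[of _ "norm g"]) (simp add: res_def)
    then show ?thesis using E unfolding sub_dual_def
      by (simp add: res_def subspace_add subspace_scale blinfun.add_right blinfun.scaleR_right)
  qed
  \<comment> \<open>The bound uses the size of \<open>g\<close> on \<open>E\<close> only. With
    \<open>c = 1\<close> it gives the constant for contractions on \<open>E\<close>, which keeps the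
    approximants inside \<open>E\<close>; with \<open>c = norm g\<close> it gives boundedness of
    \<open>\<Psi>\<close>.\<close>
  have bound: "\<bar>\<Phi> (res g)\<bar> \<le> \<bar>K0\<bar> * c"
    if c: "0 \<le> c" "\<And>x. x \<in> E \<Longrightarrow> \<bar>blinfun_apply g x\<bar> \<le> c * norm x" for g c
  proof -
    let ?A = "{\<bar>res g x\<bar> | x. x \<in> E \<and> norm x \<le> 1}"
    have le: "a \<le> c" if "a \<in> ?A" for a
    proof -
      from that obtain x where x: "a = \<bar>blinfun_apply g x\<bar>" "x \<in> E" "norm x \<le> 1"
        by (auto simp: res_def)
      have "\<bar>blinfun_apply g x\<bar> \<le> c * norm x" by (rule c(2)[OF x(2)])
      also have "\<dots> \<le> c * 1" using x(3) c(1) by (rule mult_left_mono)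
      finally show ?thesis using x(1) by simp
    qed
    have zero: "0 \<in> ?A" using E0 by (auto simp: res_def blinfun.zero_right intro!: exI[of _ 0])
    have "Sup ?A \<le> c" using zero le by (intro cSup_least) auto
    moreover have "0 \<le> Sup ?A" using zero le by (intro cSup_upper bdd_aboveI[of _ c])
    ultimately have n: "0 \<le> sub_dual_norm E (res g)" "sub_dual_norm E (res g) \<le> c"
      by (simp_all add: sub_dual_norm_def)
    have "\<bar>\<Phi> (res g)\<bar> \<le> K0 * sub_dual_norm E (res g)" by (rule Phi(3)[OF res_dual])
    also have "\<dots> \<le> \<bar>K0\<bar> * c" using n by (intro mult_mono) simp_all
    finally show ?thesis .
  qed
  define \<Psi> where "\<Psi> = Blinfun (\<lambda>g. \<Phi> (res g))"
  have "bounded_linear (\<lambda>g. \<Phi> (res g))"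
  proof (rule bounded_linear_intro)
    fix g h :: "'a \<Rightarrow>\<^sub>L real" and r :: real
    have "res (g + h) = (\<lambda>x. res g x + res h x)" by (auto simp: res_def blinfun.add_left)
    then show "\<Phi> (res (g + h)) = \<Phi> (res g) + \<Phi> (res h)" by (simp add: Phi(1) res_dual)
    have "res (r *\<^sub>R g) = (\<lambda>x. r * res g x)" by (auto simp: res_def blinfun.scaleR_left)
    then show "\<Phi> (res (r *\<^sub>R g)) = r *\<^sub>R \<Phi> (res g)" by (simp add: Phi(2) res_dual)
    have "\<bar>\<Phi> (res g)\<bar> \<le> \<bar>K0\<bar> * norm g"
      by (rule bound) (use norm_blinfun[of g] in auto)
    then show "norm (\<Phi> (res g)) \<le> norm g * \<bar>K0\<bar>" by (simp add: mult.commute)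
  qed
  then have Psi: "\<Psi> g = \<Phi> (res g)" for g
    unfolding \<Psi>_def by (simp add: bounded_linear_Blinfun_apply)
  have K: "\<Psi> g \<le> \<bar>K0\<bar>" if "\<And>x. x \<in> E \<Longrightarrow> \<bar>blinfun_apply g x\<bar> \<le> norm x" for g
    using bound[of 1 g] that by (simp add: Psi)
  \<comment> \<open>The condition on images is made vacuous by the zero operator into the reals and
    the target point 0.\<close>
  have y: "\<Psi> (h o\<^sub>L 0) = h 0" for h :: "real \<Rightarrow>\<^sub>L real"
  proof -
    have "h o\<^sub>L (0 :: 'a \<Rightarrow>\<^sub>L real) = 0" by (rule blinfun_eqI) (simp add: blinfun.zero_right)
    then show ?thesis by (simp add: blinfun.zero_right)
  qed
  obtain x where x: "\<And>g. \<Psi> g = blinfun_apply g x"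
    by (rule bidual_element_is_evaluation[OF oc E abs_ge_zero[of K0] K y])
      (auto intro: dispersed_no_almost_disjoint[OF E disp])
  have "x \<in> E"
  proof -
    obtain h :: "'a \<Rightarrow>\<^sub>L real" where h: "\<And>z. z \<in> E \<Longrightarrow> h z = 0" "h x = infdist x E"
      by (rule exists_functional_infdist[OF E, of x]) (rule that)
    have "res h = res 0" using h(1) by (auto simp: res_def)
    then have "h x = \<Psi> 0" using Psi[of h] Psi[of 0] x[of h] by metis
    then have "infdist x E = 0" using h(2) by (simp add: blinfun.zero_right)
    then show ?thesis using cl E0 in_closed_iff_infdist_zero[of E x] by blast
  qed
  moreover have "\<Phi> g = g x" if g: "g \<in> sub_dual E" for g
  proof -
    have add: "\<And>x y. x \<in> E \<Longrightarrow> y \<in> E \<Longrightarrow> g (x + y) = g x + g y"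
      and scale: "\<And>c x. x \<in> E \<Longrightarrow> g (c *\<^sub>R x) = c * g x"
      using g unfolding sub_dual_def by blast+
    obtain K where "\<And>z. z \<in> E \<Longrightarrow> \<bar>g z\<bar> \<le> K * norm z" using g unfolding sub_dual_def by blast
    then obtain h :: "'a \<Rightarrow>\<^sub>L real" where h: "\<And>z. z \<in> E \<Longrightarrow> h z = g z"
      using hahn_banach_norm_extension[OF E add scale, of K] by blast
    have "res h = g" using h g by (auto simp: res_def sub_dual_def)
    then show ?thesis using x[of h] h[OF \<open>x \<in> E\<close>] by (simp add: Psi)
  qed
  ultimately show "\<exists>x\<in>E. \<forall>g\<in>sub_dual E. \<Phi> g = g x" by blast
qed

theorem mainTheorem3:
  assumes "order_continuous TYPE('a::banach_lattice)"
  shows "(\<forall>E::'a set. closed E \<and> subspace E \<and> dispersed E \<longrightarrow> reflexive_subspace E)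
       \<and> (\<forall>T :: 'a \<Rightarrow>\<^sub>L 'b::banach. DNS T \<longrightarrow> tauberian T)"
  using dispersed_imp_reflexive[OF assms] DNS_imp_tauberian[OF assms] by blast

end
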